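(* Let $G=SL(n,\mathbb{C})$ with simple roots $\alpha_1,\dots,\alpha_{n-1}$. For every simple root $\alpha\notin\{\alpha_1,\alpha_{n-1}\}$ there exists a nonconstant morphism from $\mathbb{P}^3$ to $G/P_{\alpha}$, where $P_\alpha$ is the minimal parabolic subgroup associated with $\alpha$.
   Context: Varieties are over $\mathbb{C}$, and morphism means morphism of algebraic varieties. $B\subset G$ is the Borel subgroup of upper triangular matrices and $T$ the maximal torus of diagonal matrices; $\epsilon_i$ is the character of $T$ sending $\mathrm{diag}(t_1,\dots,t_n)$ to $t_i$; the simple roots are $\alpha_i=\epsilon_i-\epsilon_{i+1}$ for $1\le i\le n-1$; the Weyl group is $S_n$, with $s_{\alpha_i}$ the transposition of $i$ and $i+1$. The minimal parabolic subgroup associated with $\alpha_i$ is $P_{\alpha_i}=B\cup Bs_{\alpha_i}B$. Equivalently, $G/P_{\alpha_i}$ is the variety of partial flags in $\mathbb{C}^n$ consisting of nested subspaces of every dimension in $\{1,\dots,n-1\}\setminus\{i\}$. *)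

theory Defs
  imports
    "HOL-Analysis.Abstract_Topology"
    "HOL-Algebra.Left_Coset"
    "HOL-Combinatorics.Transposition"
    "Jordan_Normal_Form.Determinant"
begin

section \<open>Spaces with functions over the complex numbers\<close>

text \<open>
  A complex variety in the classical sense is encoded by its set of closed points with the Zariski
  topology, together with the regular complex-valued functions on each open set. Functions are
  total in HOL, so \<open>regular X U\<close> only constrains the values on \<open>U\<close>, and it is meaningful
  only for open \<open>U\<close>.
\<close>

record 'a space_with_functions =
  zariski :: "'a topology"
  regular :: "'a set \<Rightarrow> ('a \<Rightarrow> complex) set"

abbreviation points :: "'a space_with_functions \<Rightarrow> 'a set" where
  "points X \<equiv> topspace (zariski X)"

definition morphism ::
  "'a space_with_functions \<Rightarrow> 'b space_with_functions \<Rightarrow> ('a \<Rightarrow> 'b) \<Rightarrow> bool" where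
  "morphism X Y \<phi> \<longleftrightarrow>
     continuous_map (zariski X) (zariski Y) \<phi> \<and>
     (\<forall>V f. openin (zariski Y) V \<longrightarrow> f \<in> regular Y V \<longrightarrow>
        f \<circ> \<phi> \<in> regular X {x \<in> points X. \<phi> x \<in> V})"

text \<open>
  The quotient of a space with functions by a map \<open>\<pi>\<close>: the quotient topology, and as regular
  functions on \<open>V\<close> those whose pullback along \<open>\<pi>\<close> is regular. For an algebraic group \<open>G\<close>, a closed
  subgroup \<open>H\<close> and the projection onto \<open>G/H\<close> this is the usual variety structure on \<open>G/H\<close>
  (Borel; Springer, Linear Algebraic Groups, 5.3).
\<close>

definition quotient_space ::
  "'a space_with_functions \<Rightarrow> ('a \<Rightarrow> 'b) \<Rightarrow> 'b space_with_functions" where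
  "quotient_space X \<pi> =
     \<lparr>zariski = topology (\<lambda>V. V \<subseteq> \<pi> ` points X \<and>
                              openin (zariski X) {x \<in> points X. \<pi> x \<in> V}),
      regular = (\<lambda>V. {f. f \<circ> \<pi> \<in> regular X {x \<in> points X. \<pi> x \<in> V}})\<rparr>"

lemma istopology_quotient:
  "istopology (\<lambda>V. V \<subseteq> \<pi> ` topspace X \<and> openin X {x \<in> topspace X. \<pi> x \<in> V})"
proof -
  have "openin X {x \<in> topspace X. \<pi> x \<in> S \<inter> T}"
    if "openin X {x \<in> topspace X. \<pi> x \<in> S}" "openin X {x \<in> topspace X. \<pi> x \<in> T}" for S T
  proof -
    have "{x \<in> topspace X. \<pi> x \<in> S \<inter> T} =
          {x \<in> topspace X. \<pi> x \<in> S} \<inter> {x \<in> topspace X. \<pi> x \<in> T}" by auto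
    then show ?thesis using that by auto
  qed
  moreover have "openin X {x \<in> topspace X. \<pi> x \<in> \<Union>K}"
    if "\<And>S. S \<in> K \<Longrightarrow> openin X {x \<in> topspace X. \<pi> x \<in> S}" for K
  proof -
    have "{x \<in> topspace X. \<pi> x \<in> \<Union>K} = (\<Union>S\<in>K. {x \<in> topspace X. \<pi> x \<in> S})" by auto
    then show ?thesis using that by auto
  qed
  ultimately show ?thesis unfolding istopology_def by blast
qed

lemma openin_quotient_space:
  "openin (zariski (quotient_space X \<pi>)) V \<longleftrightarrow>
     V \<subseteq> \<pi> ` points X \<and> openin (zariski X) {x \<in> points X. \<pi> x \<in> V}"
  by (simp add: quotient_space_def topology_inverse'[OF istopology_quotient])

lemma points_quotient_space: "points (quotient_space X \<pi>) = \<pi> ` points X"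
proof
  show "points (quotient_space X \<pi>) \<subseteq> \<pi> ` points X"
    using openin_topspace[of "zariski (quotient_space X \<pi>)"]
    unfolding openin_quotient_space by (rule conjunct1)
  have "{x \<in> points X. \<pi> x \<in> \<pi> ` points X} = points X" by auto
  then have "openin (zariski (quotient_space X \<pi>)) (\<pi> ` points X)"
    by (simp add: openin_quotient_space)
  then show "\<pi> ` points X \<subseteq> points (quotient_space X \<pi>)" by (rule openin_subset)
qed


section \<open>Polynomial functions, affine varieties and projective space\<close>

text \<open>
  Polynomials are identified with polynomial functions: the algebra generated over the complex
  numbers by a set \<open>C\<close> of coordinate functions, and its homogeneous elements of degree \<open>d\<close>.
\<close>

inductive_set poly_fun :: "('a \<Rightarrow> complex) set \<Rightarrow> ('a \<Rightarrow> complex) set"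
  for C :: "('a \<Rightarrow> complex) set" where
  const: "(\<lambda>_. c) \<in> poly_fun C"
| coord: "f \<in> C \<Longrightarrow> f \<in> poly_fun C"
| add: "p \<in> poly_fun C \<Longrightarrow> q \<in> poly_fun C \<Longrightarrow> (\<lambda>x. p x + q x) \<in> poly_fun C"
| mult: "p \<in> poly_fun C \<Longrightarrow> q \<in> poly_fun C \<Longrightarrow> (\<lambda>x. p x * q x) \<in> poly_fun C"

inductive hom_poly_fun :: "('a \<Rightarrow> complex) set \<Rightarrow> nat \<Rightarrow> ('a \<Rightarrow> complex) \<Rightarrow> bool"
  for C :: "('a \<Rightarrow> complex) set" where
  const: "hom_poly_fun C 0 (\<lambda>_. c)"
| coord: "f \<in> C \<Longrightarrow> hom_poly_fun C 1 f"
| add: "hom_poly_fun C d p \<Longrightarrow> hom_poly_fun C d q \<Longrightarrow> hom_poly_fun C d (\<lambda>x. p x + q x)"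
| mult: "hom_poly_fun C d p \<Longrightarrow> hom_poly_fun C e q \<Longrightarrow> hom_poly_fun C (d + e) (\<lambda>x. p x * q x)"

text \<open>
  The subset \<open>S\<close> of an affine space with coordinate functions \<open>C\<close>: the topology is generated by the
  sets where a polynomial does not vanish, and regular functions are locally quotients of
  polynomials.
\<close>

definition affine_space_topology :: "('a \<Rightarrow> complex) set \<Rightarrow> 'a set \<Rightarrow> 'a topology" where
  "affine_space_topology C S = topology_generated_by {{x \<in> S. p x \<noteq> 0} | p. p \<in> poly_fun C}"

definition affine_variety :: "('a \<Rightarrow> complex) set \<Rightarrow> 'a set \<Rightarrow> 'a space_with_functions" where
  "affine_variety C S =
     \<lparr>zariski = affine_space_topology C S,
      regular = (\<lambda>U. {f. \<forall>x\<in>U. \<exists>W p q. openin (affine_space_topology C S) W \<and> x \<in> W \<and> W \<subseteq> U \<and>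
                   p \<in> poly_fun C \<and> q \<in> poly_fun C \<and>
                   (\<forall>y\<in>W. q y \<noteq> 0 \<and> f y = p y / q y)})\<rparr>"

lemma points_affine_variety: "points (affine_variety C S) = S"
proof
  show "points (affine_variety C S) \<subseteq> S"
    by (auto simp: affine_variety_def affine_space_topology_def)
  have "{x \<in> S. (1::complex) \<noteq> 0} \<in> {{x \<in> S. p x \<noteq> 0} | p. p \<in> poly_fun C}"
    by (rule CollectI, rule exI[of _ "\<lambda>_. 1"]) (simp add: poly_fun.const)
  from Union_upper[OF this] show "S \<subseteq> points (affine_variety C S)"
    by (simp add: affine_variety_def affine_space_topology_def)
qed

definition vec_coords :: "nat \<Rightarrow> (complex vec \<Rightarrow> complex) set" where
  "vec_coords m = {\<lambda>v. v $ k | k. k < m}"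

definition mat_coords :: "nat \<Rightarrow> (complex mat \<Rightarrow> complex) set" where
  "mat_coords n = {\<lambda>A. A $$ (a, b) | a b. a < n \<and> b < n}"

text \<open>
  Points of projective \<open>N\<close>-space are the lines through the origin in complex \<open>(N + 1)\<close>-space.
\<close>

definition line :: "complex vec \<Rightarrow> complex vec set" where
  "line v = {c \<cdot>\<^sub>v v | c. True}"

definition nonzero_vecs :: "nat \<Rightarrow> complex vec set" where
  "nonzero_vecs m = carrier_vec m - {0\<^sub>v m}"

definition projective_topology :: "nat \<Rightarrow> complex vec set topology" where
  "projective_topology N =
     topology_generated_by {line ` {v \<in> nonzero_vecs (N + 1). h v \<noteq> 0} | h d.
                              hom_poly_fun (vec_coords (N + 1)) d h}"

definition projective_space :: "nat \<Rightarrow> complex vec set space_with_functions" where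
  "projective_space N =
     \<lparr>zariski = projective_topology N,
      regular = (\<lambda>U. {f. \<forall>x\<in>U. \<exists>W d p q. openin (projective_topology N) W \<and> x \<in> W \<and> W \<subseteq> U \<and>
                   hom_poly_fun (vec_coords (N + 1)) d p \<and>
                   hom_poly_fun (vec_coords (N + 1)) d q \<and>
                   (\<forall>v\<in>nonzero_vecs (N + 1). line v \<in> W \<longrightarrow>
                      q v \<noteq> 0 \<and> f (line v) = p v / q v)})\<rparr>"

lemma points_projective_space: "points (projective_space N) = line ` nonzero_vecs (N + 1)"
proof
  show "points (projective_space N) \<subseteq> line ` nonzero_vecs (N + 1)"
    by (auto simp: projective_space_def projective_topology_def)
  have "line ` {v \<in> nonzero_vecs (N + 1). (1::complex) \<noteq> 0} \<in>
      {line ` {v \<in> nonzero_vecs (N + 1). h v \<noteq> 0} | h d. hom_poly_fun (vec_coords (N + 1)) d h}"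
    by (rule CollectI, rule exI[of _ "\<lambda>_. 1"], rule exI[of _ 0]) (simp add: hom_poly_fun.const)
  from Union_upper[OF this] show "line ` nonzero_vecs (N + 1) \<subseteq> points (projective_space N)"
    by (simp add: projective_space_def projective_topology_def)
qed


section \<open>The special linear group and its minimal parabolic subgroups\<close>

definition SL :: "nat \<Rightarrow> complex mat monoid" where
  "SL n = \<lparr>carrier = {A \<in> carrier_mat n n. det A = 1}, monoid.mult = (*), one = 1\<^sub>m n\<rparr>"

lemma group_SL: "group (SL n)"
proof (rule groupI)
  fix A assume A: "A \<in> carrier (SL n)"
  then have "A \<in> carrier_mat n n" "det A = 1" by (auto simp: SL_def)
  then obtain B where B: "B \<in> carrier_mat n n" "B * A = 1\<^sub>m n"
    using det_non_zero_imp_unit[of A n] by (auto simp: Units_def ring_mat_def)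
  then have "det B * det A = 1"
    using det_mult[OF B(1) \<open>A \<in> carrier_mat n n\<close>] by simp
  with B \<open>det A = 1\<close> show "\<exists>B\<in>carrier (SL n). B \<otimes>\<^bsub>SL n\<^esub> A = \<one>\<^bsub>SL n\<^esub>"
    by (auto simp: SL_def)
qed (auto simp: SL_def det_mult)

definition borel :: "nat \<Rightarrow> complex mat set" where
  "borel n = {b \<in> carrier (SL n). upper_triangular b}"

definition torus :: "nat \<Rightarrow> complex mat set" where
  "torus n = {t \<in> carrier (SL n). diagonal_mat t}"

text \<open>
  Indices \<open>1, \<dots>, n\<close> are used for characters, roots and permutations, whereas matrix entries are
  indexed from 0. The character group of the torus is written additively in the literature;
  characters are functions here, so \<open>\<epsilon>\<^sub>i - \<epsilon>\<^sub>j\<close> is the pointwise quotient.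
\<close>

definition eps :: "nat \<Rightarrow> nat \<Rightarrow> complex mat \<Rightarrow> complex" where
  "eps n i = (\<lambda>t\<in>torus n. t $$ (i - 1, i - 1))"

definition simple_root :: "nat \<Rightarrow> nat \<Rightarrow> complex mat \<Rightarrow> complex" where
  "simple_root n i = (\<lambda>t\<in>torus n. eps n i t / eps n (i + 1) t)"

text \<open>
  The representatives in the normaliser of the torus of a permutation \<open>w\<close>, viewed as an element of
  the Weyl group: the matrices in \<open>SL n\<close> with the nonzero pattern of the permutation matrix of \<open>w\<close>.
  They form a full coset of the torus. The permutation matrix itself need not have determinant 1.
\<close>

definition weyl_representatives :: "nat \<Rightarrow> (nat \<Rightarrow> nat) \<Rightarrow> complex mat set" where
  "weyl_representatives n w =
     {g \<in> carrier (SL n). \<forall>a\<in>{1..n}. \<forall>b\<in>{1..n}. g $$ (a - 1, b - 1) \<noteq> 0 \<longleftrightarrow> a = w b}"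

definition simple_reflection :: "nat \<Rightarrow> nat \<Rightarrow> nat" where
  "simple_reflection i = Transposition.transpose i (i + 1)"

definition minimal_parabolic :: "nat \<Rightarrow> nat \<Rightarrow> complex mat set" where
  "minimal_parabolic n i =
     borel n \<union>
     (borel n <#>\<^bsub>SL n\<^esub> weyl_representatives n (simple_reflection i) <#>\<^bsub>SL n\<^esub> borel n)"

definition SL_variety :: "nat \<Rightarrow> complex mat space_with_functions" where
  "SL_variety n = affine_variety (mat_coords n) (carrier (SL n))"

definition homogeneous_space :: "nat \<Rightarrow> complex mat set \<Rightarrow> complex mat set space_with_functions" where
  "homogeneous_space n H = quotient_space (SL_variety n) (\<lambda>g. g <#\<^bsub>SL n\<^esub> H)"

lemma points_homogeneous_space: "points (homogeneous_space n H) = lcosets\<^bsub>SL n\<^esub> H"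
  by (auto simp: homogeneous_space_def points_quotient_space SL_variety_def
      points_affine_variety LCOSETS_def)

end

theory Submission
  imports Defs
begin

text \<open>
  A symplectic form on the 4-dimensional space assigns to a line \<open>L\<close> the flag formed by \<open>L\<close> and its
  orthogonal hyperplane. Since \<open>2 \<le> i \<le> n - 2\<close>, inserting these two subspaces between the standard
  coordinate subspaces of dimensions \<open>i - 2\<close> and \<open>i + 2\<close> gives partial flags of every dimension
  except \<open>i\<close>, depending nonconstantly on \<open>L\<close>. Here the flag of \<open>L\<close> is the coset of any symplectic
  matrix whose first column spans \<open>L\<close>, embedded as a central block. On the open set where a
  suitable linear form does not vanish, such a matrix can be chosen with entries regular in \<open>L\<close>.
\<close>

section \<open>Minimal parabolic subgroups as flag stabilizers\<close>

text \<open>The omitted dimension \<open>i\<close> is that of a plane between L and its orthogonal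
  hyperplane. Such a plane cannot be chosen algebraically in L: it would be a line subbundle, with
  line bundle quotient, of the null correlation bundle (the hyperplane modulo L), making the second
  Chern class of that bundle minus a square, whereas it is 1. Lifts to SL_n are needed because the
  structure on G/P is defined by pulling functions and open sets back to SL_n, which does not
  directly control maps into G/P. They can only be local, since a morphism from projective space to
  the affine variety SL_n is constant. The source of local lifts is the big cell of Sp4: unipotent
  matrices with first column (1, x, y, z) give a polynomial lift where the first coordinate is
  nonzero, and translating by Sp4 covers all of projective space.\<close>

lemma carrier_SL_iff: "A \<in> carrier (SL n) \<longleftrightarrow> A \<in> carrier_mat n n \<and> det A = 1"
  by (simp add: SL_def)

lemma mult_SL [simp]: "A \<otimes>\<^bsub>SL n\<^esub> B = A * B"
  by (simp add: SL_def)

lemma one_SL [simp]: "\<one>\<^bsub>SL n\<^esub> = 1\<^sub>m n"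
  by (simp add: SL_def)

text \<open>Indices are 0-based, so the exception at \<open>(i, i - 1)\<close> means that
  \<open>A\<close> preserves the span of the first d basis vectors for every d except
  \<open>i\<close>. Membership in the parabolic, defined through double cosets, thereby becomes a
  condition on entries.\<close>

definition stabilizes_flag :: "nat \<Rightarrow> nat \<Rightarrow> complex mat \<Rightarrow> bool" where
  "stabilizes_flag n i A \<longleftrightarrow>
     (\<forall>a b. b < a \<longrightarrow> a < n \<longrightarrow> (a, b) \<noteq> (i, i - 1) \<longrightarrow> A $$ (a, b) = 0)"

text \<open>A nonzero term of the product is a chain from \<open>a\<close> over \<open>b\<close> to
  \<open>c\<close> whose links either do not decrease or are the drop from \<open>i\<close> to
  \<open>i - 1\<close>. Such a chain can descend in total only from \<open>i\<close> to
  \<open>i - 1\<close>.\<close>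

lemma stabilizes_flag_mult:
  assumes "A \<in> carrier_mat n n" "B \<in> carrier_mat n n"
    and "stabilizes_flag n i A" "stabilizes_flag n i B"
  shows "stabilizes_flag n i (A * B)"
  unfolding stabilizes_flag_def
proof (intro allI impI)
  fix a c assume ac: "c < a" "a < n" "(a, c) \<noteq> (i, i - 1)"
  have "A $$ (a, b) * B $$ (b, c) = 0" if "b < n" for b
  proof (rule ccontr)
    assume "A $$ (a, b) * B $$ (b, c) \<noteq> 0"
    then have "a \<le> b \<or> (a, b) = (i, i - 1)" "b \<le> c \<or> (b, c) = (i, i - 1)"
      using assms(3,4) ac that unfolding stabilizes_flag_def by (metis mult_zero_left mult_zero_right not_le)+
    with ac show False by auto
  qed
  with ac assms(1,2) show "(A * B) $$ (a, c) = 0"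
    by (auto simp: scalar_prod_def intro!: sum.neutral)
qed

text \<open>Below the diagonal only the entry at \<open>(i, i - 1)\<close> is nonzero. With it as
  pivot, one elimination step in rows \<open>i - 1\<close> and \<open>i\<close>, as in the Bruhat
  decomposition of SL_2, makes \<open>A\<close> upper triangular; \<open>u\<close> and
  \<open>w\<close> undo that step.\<close>

lemma bruhat_minimal_parabolic:
  assumes i: "1 \<le> i" "i < n" and A: "A \<in> carrier (SL n)" and "stabilizes_flag n i A"
    and nz: "A $$ (i, i - 1) \<noteq> 0"
  shows "\<exists>u\<in>borel n. \<exists>w\<in>weyl_representatives n (simple_reflection i). \<exists>b\<in>borel n. A = u * w * b"
proof -
  have An: "A \<in> carrier_mat n n" "det A = 1" using A by (auto simp: carrier_SL_iff)
  have A0: "A $$ (a, b) = 0" if "b < a" "a < n" "a = i \<Longrightarrow> b \<noteq> i - 1" for a b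
    using assms(4) that unfolding stabilizes_flag_def by blast
  have ii: "i - 1 < n" "i - 1 \<noteq> i" using i by auto
  define r where "r = A $$ (i - 1, i - 1) / A $$ (i, i - 1)"
  define A' where "A' = addrow (- r) (i - 1) i A"
  \<comment> \<open>In \<open>A'\<close> the entry at \<open>(i - 1, i - 1)\<close> has been
    cleared, so swapping the two rows gives an upper triangular matrix. The swap has determinant -1,
    and negating row \<open>i\<close> compensates for it.\<close>
  define b where "b = multrow i (-1) (swaprows (i - 1) i A')"
  define u :: "complex mat" where "u = addrow_mat n r (i - 1) i"
  define w :: "complex mat" where "w = swaprows_mat n (i - 1) i * multrow_mat n i (-1)"
  have w_eq: "w = swaprows (i - 1) i (multrow_mat n i (-1))"
    unfolding w_def using i ii by (intro swaprows_mat[symmetric, where nc = n]) auto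
  have A': "A' \<in> carrier_mat n n" "det A' = 1"
    using An i ii by (auto simp: A'_def det_addrow[where n = n])
  have b: "b \<in> carrier_mat n n"
    using A' by (simp add: b_def)
  have "det b = 1"
    using A' i ii by (simp add: b_def det_multrow[where n = n] det_swaprows[where n = n])
  moreover have "b $$ (a, c) = 0" if "c < a" "a < n" for a c
  proof -
    have b_index: "b $$ (a, c) = (if a = i - 1 then A $$ (i, c)
        else if a = i then r * A $$ (i, c) - A $$ (i - 1, c) else A $$ (a, c))"
      using that i ii An(1) by (simp add: b_def A'_def)
    have "c = i - 1 \<or> c < i - 1" if "a = i"
      using that \<open>c < a\<close> by arith
    then consider "a = i - 1" | "a = i" "c = i - 1" | "a = i" "c < i - 1" | "a \<noteq> i - 1" "a \<noteq> i"
      by blast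
    then show ?thesis
    proof cases
      case 1
      then show ?thesis using that i A0[of c i] unfolding b_index by simp
    next
      case 2
      then show ?thesis using ii nz unfolding b_index r_def by simp
    next
      case 3
      then show ?thesis using i ii A0[of c i] A0[of c "i - 1"] unfolding b_index by simp
    next
      case 4
      then show ?thesis using that A0[of c a] unfolding b_index by simp
    qed
  qed
  ultimately have "b \<in> borel n"
    using b by (auto simp: borel_def carrier_SL_iff)
  moreover have "u \<in> borel n"
    using i ii by (auto simp: u_def borel_def carrier_SL_iff det_addrow_mat upper_triangular_def)
  moreover have "w \<in> weyl_representatives n (simple_reflection i)"
  proof -
    have "det w = 1"
      unfolding w_def using i ii
      by (subst det_mult[where n = n]) (auto simp: det_swaprows_mat det_multrow_mat)
    moreover have "w $$ (a - 1, c - 1) \<noteq> 0 \<longleftrightarrow> a = Transposition.transpose i (i + 1) c"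
      if "a \<in> {1..n}" "c \<in> {1..n}" for a c
    proof -
      obtain x y where xy: "a = Suc x" "c = Suc y" "x < n" "y < n"
        using \<open>a \<in> {1..n}\<close> \<open>c \<in> {1..n}\<close> by (cases a; cases c) auto
      \<comment> \<open>The 0-based positions \<open>j\<close> and \<open>i\<close> are the 1-based
        indices \<open>i\<close> and \<open>i + 1\<close> that the reflection exchanges.\<close>
      obtain j where j: "i = Suc j" using i by (cases i) auto
      have "w $$ (x, y) = (if x = j then (if y = i then -1 else 0)
          else if x = i then (if y = j then 1 else 0) else if x = y then 1 else 0)"
        using xy(3,4) i by (simp add: w_eq j)
      then show ?thesis by (simp add: xy j Transposition.transpose_def)
    qed
    ultimately show ?thesis
      by (auto simp: weyl_representatives_def simple_reflection_def carrier_SL_iff w_def)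
  qed
  moreover have "A = u * w * b"
  proof -
    have "u * w * b = u * (w * b)"
      using b by (intro assoc_mult_mat[of _ n n _ n _ n]) (auto simp: u_def w_def)
    also have "w * b = swaprows_mat n (i - 1) i * (multrow_mat n i (-1) * b)"
      unfolding w_def using b by (intro assoc_mult_mat[of _ n n _ n _ n]) auto
    also have "\<dots> = swaprows (i - 1) i (multrow i (-1) b)"
      using b i ii by (simp add: multrow_mat[of b n n] swaprows_mat[of _ n n] mult_carrier_mat[of _ n n])
    also have "\<dots> = A'"
      using A' i ii by (intro eq_matI) (auto simp: b_def)
    also have "u * A' = addrow r (i - 1) i A'"
      unfolding u_def using A' i by (intro addrow_mat[symmetric]) auto
    also have "\<dots> = A"
      using An i ii by (intro eq_matI) (auto simp: A'_def)
    finally show ?thesis by simp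
  qed
  ultimately show ?thesis by blast
qed

text \<open>The entry at \<open>(i, i - 1)\<close> separates the two Bruhat cells: it is zero
  exactly on the Borel part. Conversely both cells lie in the stabilizer, which is closed under
  products.\<close>

lemma minimal_parabolic_eq:
  assumes "1 \<le> i" "i < n"
  shows "minimal_parabolic n i = {A \<in> carrier (SL n). stabilizes_flag n i A}"
proof (intro equalityI subsetI)
  fix A assume "A \<in> {A \<in> carrier (SL n). stabilizes_flag n i A}"
  then have A: "A \<in> carrier (SL n)" "stabilizes_flag n i A" by auto
  show "A \<in> minimal_parabolic n i"
  proof (cases "A $$ (i, i - 1) = 0")
    case True
    with A have "upper_triangular A"
      unfolding upper_triangular_def stabilizes_flag_def
      by (metis carrier_SL_iff carrier_matD(1) prod.inject)
    with A show ?thesis by (simp add: minimal_parabolic_def borel_def)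
  next
    case False
    then show ?thesis
      using bruhat_minimal_parabolic[OF assms A]
      unfolding minimal_parabolic_def set_mult_def by auto
  qed
next
  fix A assume A: "A \<in> minimal_parabolic n i"
  have borel: "b \<in> carrier (SL n)" "stabilizes_flag n i b" if "b \<in> borel n" for b
    using that by (auto simp: borel_def carrier_SL_iff stabilizes_flag_def)
  have weyl: "w \<in> carrier (SL n)" "stabilizes_flag n i w"
    if "w \<in> weyl_representatives n (simple_reflection i)" for w
  proof -
    show "w \<in> carrier (SL n)" using that by (simp add: weyl_representatives_def)
    show "stabilizes_flag n i w"
      unfolding stabilizes_flag_def
    proof (intro allI impI)
      fix a b assume ab: "b < a" "a < n" "(a, b) \<noteq> (i, i - 1)"
      have "\<forall>a\<in>{1..n}. \<forall>b\<in>{1..n}.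
          w $$ (a - 1, b - 1) \<noteq> 0 \<longleftrightarrow> a = Transposition.transpose i (i + 1) b"
        using that by (simp add: weyl_representatives_def simple_reflection_def)
      from this[rule_format, of "a + 1" "b + 1"] ab
      have "w $$ (a, b) \<noteq> 0 \<longleftrightarrow> a + 1 = Transposition.transpose i (i + 1) (b + 1)"
        by simp
      with ab show "w $$ (a, b) = 0"
        by (auto simp: Transposition.transpose_def split: if_splits)
    qed
  qed
  interpret group "SL n" by (rule group_SL)
  from A consider "A \<in> borel n" | u w b where "u \<in> borel n"
      "w \<in> weyl_representatives n (simple_reflection i)" "b \<in> borel n" "A = u * w * b"
    unfolding minimal_parabolic_def set_mult_def by auto
  then show "A \<in> {A \<in> carrier (SL n). stabilizes_flag n i A}"
  proof cases
    case 1
    then show ?thesis using borel by simp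
  next
    case 2
    then have "A \<in> carrier (SL n)"
      using borel weyl by (metis m_closed mult_SL)
    moreover have "stabilizes_flag n i A"
      unfolding \<open>A = u * w * b\<close> using 2 borel weyl
      by (intro stabilizes_flag_mult) (auto simp: carrier_SL_iff intro!: mult_carrier_mat[where n = n])
    ultimately show ?thesis by simp
  qed
qed

section \<open>The symplectic group of rank two\<close>

text \<open>The antidiagonal form is the one adapted to upper triangular matrices: the orthogonal
  complement of e_0 is again a coordinate subspace of the standard flag, the span of e_0, e_1,
  e_2.\<close>

definition symplectic_form :: "complex mat" where
  "symplectic_form = mat 4 4 (\<lambda>(a, b). if a + b = 3 then if a < b then 1 else -1 else 0)"

definition Sp4 :: "complex mat set" where
  "Sp4 = {A \<in> carrier (SL 4). transpose_mat A * symplectic_form * A = symplectic_form}"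

lemma symplectic_form_carrier [simp]: "symplectic_form \<in> carrier_mat 4 4"
  by (simp add: symplectic_form_def)

lemma less_4_cases: "a < 4 \<Longrightarrow> a = 0 \<or> a = 1 \<or> a = 2 \<or> a = (3::nat)"
  by auto

lemma sum_less_4: "(\<Sum>a = 0..<(4::nat). f a) = f 0 + f 1 + f 2 + (f 3 :: 'a :: comm_monoid_add)"
  by (simp add: numeral_eq_Suc)

text \<open>This is the Gram matrix of the columns: the right-hand side is the form evaluated on
  columns \<open>a\<close> and \<open>b\<close>. Hence \<open>Sp4_iff\<close> says that the columns
  are a symplectic basis.\<close>

lemma symplectic_form_index:
  assumes A: "A \<in> carrier_mat 4 4" and ab: "a < 4" "b < 4"
  shows "(transpose_mat A * symplectic_form * A) $$ (a, b) =
    A $$ (0, a) * A $$ (3, b) + A $$ (1, a) * A $$ (2, b)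
      - A $$ (2, a) * A $$ (1, b) - A $$ (3, a) * A $$ (0, b)"
proof -
  define B where "B = transpose_mat A * symplectic_form"
  have B: "B \<in> carrier_mat 4 4" using A by (simp add: B_def)
  have "B $$ (a, c) =
      (if c = 0 then - A $$ (3, a) else if c = 1 then - A $$ (2, a)
       else if c = 2 then A $$ (1, a) else A $$ (0, a))" if "c < 4" for c
    using less_4_cases[OF that] A ab
    by (auto simp: B_def scalar_prod_def sum_less_4 symplectic_form_def)
  then have "(B * A) $$ (a, b) =
    A $$ (0, a) * A $$ (3, b) + A $$ (1, a) * A $$ (2, b)
      - A $$ (2, a) * A $$ (1, b) - A $$ (3, a) * A $$ (0, b)"
    using A B ab by (simp add: scalar_prod_def sum_less_4)
  then show ?thesis by (simp add: B_def)
qed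

lemma Sp4_iff:
  "A \<in> Sp4 \<longleftrightarrow> A \<in> carrier (SL 4) \<and> (\<forall>a<4. \<forall>b<4.
     A $$ (0, a) * A $$ (3, b) + A $$ (1, a) * A $$ (2, b)
       - A $$ (2, a) * A $$ (1, b) - A $$ (3, a) * A $$ (0, b) = symplectic_form $$ (a, b))"
proof (cases "A \<in> carrier (SL 4)")
  case True
  then have A: "A \<in> carrier_mat 4 4" by (simp add: carrier_SL_iff)
  have "transpose_mat A * symplectic_form * A \<in> carrier_mat 4 4" using A by auto
  then have "transpose_mat A * symplectic_form * A = symplectic_form \<longleftrightarrow>
      (\<forall>a<4. \<forall>b<4. (transpose_mat A * symplectic_form * A) $$ (a, b) = symplectic_form $$ (a, b))"
    using symplectic_form_carrier by (metis (no_types, lifting) carrier_matD eq_matI)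
  with True A show ?thesis by (simp add: Sp4_def symplectic_form_index del: index_mult_mat)
qed (simp add: Sp4_def)

lemma subgroup_Sp4: "subgroup Sp4 (SL 4)"
proof -
  interpret group "SL 4" by (rule group_SL)
  let ?J = symplectic_form
  show ?thesis
  proof (rule subgroupI)
    have "1\<^sub>m 4 \<in> Sp4"
      by (simp add: Sp4_def carrier_SL_iff left_mult_one_mat[of _ 4 4] right_mult_one_mat[of _ 4 4])
    then show "Sp4 \<noteq> {}" by blast
  next
    fix A assume A: "A \<in> Sp4"
    define B where "B = inv\<^bsub>SL 4\<^esub> A"
    have carrA: "A \<in> carrier (SL 4)" using A by (simp add: Sp4_def)
    then have carrB: "B \<in> carrier (SL 4)" by (simp add: B_def)
    have AB: "A * B = 1\<^sub>m 4"
      using r_inv[OF carrA] by (simp add: B_def)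
    have c: "A \<in> carrier_mat 4 4" "B \<in> carrier_mat 4 4"
      using carrA carrB by (auto simp: carrier_SL_iff)
    have "transpose_mat B * ?J * B = transpose_mat B * (transpose_mat A * ?J * A) * B"
      using A by (simp add: Sp4_def)
    also have "\<dots> = (transpose_mat B * transpose_mat A) * ?J * (A * B)"
      using c by (simp add: assoc_mult_mat[of _ 4 4 _ 4 _ 4] mult_carrier_mat[of _ 4 4 _ 4])
    also have "transpose_mat B * transpose_mat A = 1\<^sub>m 4"
      using transpose_mult[OF c] AB by simp
    finally have "transpose_mat B * ?J * B = ?J"
      using AB by (simp add: left_mult_one_mat[of _ 4 4] right_mult_one_mat[of _ 4 4])
    with carrB show "inv\<^bsub>SL 4\<^esub> A \<in> Sp4" by (simp add: Sp4_def B_def)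
  next
    fix A B assume AB: "A \<in> Sp4" "B \<in> Sp4"
    then have c: "A \<in> carrier_mat 4 4" "B \<in> carrier_mat 4 4"
      by (auto simp: Sp4_def carrier_SL_iff)
    have "transpose_mat (A * B) * ?J * (A * B) = transpose_mat B * (transpose_mat A * ?J * A) * B"
      using c by (simp add: transpose_mult[OF c] assoc_mult_mat[of _ 4 4 _ 4 _ 4] mult_carrier_mat[of _ 4 4 _ 4])
    also have "\<dots> = ?J" using AB by (simp add: Sp4_def)
    finally show "A \<otimes>\<^bsub>SL 4\<^esub> B \<in> Sp4"
      using AB m_closed[of A B] by (simp add: Sp4_def)
  qed (simp add: Sp4_def)
qed

(* Fixing the line of e_0, a symplectic matrix fixes its orthogonal complement <e_0, e_1, e_2>. *)
lemma Sp4_stabilizes_flag_iff: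
  assumes "A \<in> Sp4"
  shows "stabilizes_flag 4 2 A \<longleftrightarrow> A $$ (1, 0) = 0 \<and> A $$ (2, 0) = 0 \<and> A $$ (3, 0) = 0"
proof
  assume "stabilizes_flag 4 2 A"
  then show "A $$ (1, 0) = 0 \<and> A $$ (2, 0) = 0 \<and> A $$ (3, 0) = 0"
    by (simp add: stabilizes_flag_def)
next
  assume col: "A $$ (1, 0) = 0 \<and> A $$ (2, 0) = 0 \<and> A $$ (3, 0) = 0"
  have "A $$ (0, 0) * A $$ (3, b) = symplectic_form $$ (0, b)" if "b < 4" for b
    using assms col that unfolding Sp4_iff by force
  \<comment> \<open>The instance 3 gives \<open>A $$ (0, 0) * A $$ (3, 3) = 1\<close>, so the factor
    \<open>A $$ (0, 0)\<close> can be cancelled in the other two.\<close>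
  from this[of 1] this[of 2] this[of 3] have "A $$ (3, 1) = 0" "A $$ (3, 2) = 0"
    by (auto simp: symplectic_form_def)
  moreover have "A $$ (a, b) = 0"
    if "b < a" "a < 4" "(a, b) \<noteq> (2, 1)" "A $$ (3, 1) = 0" "A $$ (3, 2) = 0" for a b
    using less_4_cases[of a] less_4_cases[of b] that col by auto
  ultimately show "stabilizes_flag 4 2 A"
    unfolding stabilizes_flag_def by simp
qed

text \<open>These matrices form the unipotent radical of the parabolic opposite to the stabilizer of
  the line of e_0. The first column is an arbitrary vector with leading coordinate 1; the entries
  \<open>y\<close> and \<open>- x\<close> in the bottom row are then forced by making column 0
  orthogonal to columns 1 and 2.\<close>

definition Sp4_unipotent :: "complex \<Rightarrow> complex \<Rightarrow> complex \<Rightarrow> complex mat" where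
  "Sp4_unipotent x y z = mat 4 4 (\<lambda>(a, b).
     [[1, 0,   0, 0],
      [x, 1,   0, 0],
      [y, 0,   1, 0],
      [z, y, - x, 1]] ! a ! b)"

lemma Sp4_unipotent_carrier [simp]: "Sp4_unipotent x y z \<in> carrier_mat 4 4"
  by (simp add: Sp4_unipotent_def)

lemma Sp4_unipotent_dim [simp]:
  "dim_row (Sp4_unipotent x y z) = 4" "dim_col (Sp4_unipotent x y z) = 4"
  by (simp_all add: Sp4_unipotent_def)

lemma Sp4_unipotent_row_0: "b < 4 \<Longrightarrow> Sp4_unipotent x y z $$ (0, b) = (if b = 0 then 1 else 0)"
  and Sp4_unipotent_row_1: "b < 4 \<Longrightarrow> Sp4_unipotent x y z $$ (1, b) =
    (if b = 0 then x else if b = 1 then 1 else 0)"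
  and Sp4_unipotent_row_2: "b < 4 \<Longrightarrow> Sp4_unipotent x y z $$ (2, b) =
    (if b = 0 then y else if b = 2 then 1 else 0)"
  and Sp4_unipotent_row_3: "b < 4 \<Longrightarrow> Sp4_unipotent x y z $$ (3, b) =
    (if b = 0 then z else if b = 1 then y else if b = 2 then - x else 1)"
  using less_4_cases[of b] by (auto simp: Sp4_unipotent_def)

lemmas Sp4_unipotent_rows =
  Sp4_unipotent_row_0 Sp4_unipotent_row_1[simplified] Sp4_unipotent_row_2 Sp4_unipotent_row_3

lemma det_Sp4_unipotent: "det (Sp4_unipotent x y z) = 1"
proof -
  have "Sp4_unipotent x y z $$ (a, b) = 0" if "a < b" "b < 4" for a b
    using less_4_cases[of a] that by (auto simp: Sp4_unipotent_rows)
  from det_lower_triangular[OF this Sp4_unipotent_carrier]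
  have "det (Sp4_unipotent x y z) = (\<Prod>a = 0..<4. Sp4_unipotent x y z $$ (a, a))"
    by (simp add: prod_list_diag_prod)
  also have "\<dots> = 1"
  proof (intro prod.neutral ballI)
    fix a :: nat assume "a \<in> {0..<4}"
    then show "Sp4_unipotent x y z $$ (a, a) = 1"
      using less_4_cases[of a] by (auto simp: Sp4_unipotent_rows)
  qed
  finally show ?thesis .
qed

lemma Sp4_unipotent_in_Sp4: "Sp4_unipotent x y z \<in> Sp4"
  unfolding Sp4_iff carrier_SL_iff
proof (intro conjI allI impI)
  let ?A = "Sp4_unipotent x y z"
  fix a b :: nat assume "a < 4" "b < 4"
  show "?A $$ (0, a) * ?A $$ (3, b) + ?A $$ (1, a) * ?A $$ (2, b) -
      ?A $$ (2, a) * ?A $$ (1, b) - ?A $$ (3, a) * ?A $$ (0, b) = symplectic_form $$ (a, b)"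
    using less_4_cases[OF \<open>a < 4\<close>] less_4_cases[OF \<open>b < 4\<close>]
    by (elim disjE) (simp_all add: Sp4_unipotent_rows symplectic_form_def)
qed (simp_all add: det_Sp4_unipotent)

text \<open>The transpose has first row (1, x, y, z), so it supplies symplectic matrices whose first
  coordinate function does not vanish at a given vector.\<close>

lemma transpose_Sp4_unipotent_in_Sp4: "transpose_mat (Sp4_unipotent x y z) \<in> Sp4"
  unfolding Sp4_iff carrier_SL_iff
proof (intro conjI allI impI)
  let ?A = "transpose_mat (Sp4_unipotent x y z)"
  fix a b :: nat assume "a < 4" "b < 4"
  show "?A $$ (0, a) * ?A $$ (3, b) + ?A $$ (1, a) * ?A $$ (2, b) -
      ?A $$ (2, a) * ?A $$ (1, b) - ?A $$ (3, a) * ?A $$ (0, b) = symplectic_form $$ (a, b)"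
    using less_4_cases[OF \<open>a < 4\<close>] less_4_cases[OF \<open>b < 4\<close>]
    by (elim disjE) (simp_all add: Sp4_unipotent_rows symplectic_form_def)
qed (simp_all add: det_Sp4_unipotent det_transpose[OF Sp4_unipotent_carrier])

section \<open>Embedding 4 by 4 matrices as a central diagonal block\<close>

definition central_block :: "nat \<Rightarrow> nat \<Rightarrow> complex mat \<Rightarrow> complex mat" where
  "central_block m k A =
     four_block_mat (1\<^sub>m m) (0\<^sub>m m (4 + k)) (0\<^sub>m (4 + k) m)
       (four_block_mat A (0\<^sub>m 4 k) (0\<^sub>m k 4) (1\<^sub>m k))"

lemma central_block_carrier:
  assumes "A \<in> carrier_mat 4 4"
  shows "central_block m k A \<in> carrier_mat (m + 4 + k) (m + 4 + k)"
  using carrier_matD[OF assms] by (intro carrier_matI) (simp_all add: central_block_def)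

lemma central_block_index:
  assumes "A \<in> carrier_mat 4 4" "a < m + 4 + k" "b < m + 4 + k"
  shows "central_block m k A $$ (a, b) =
    (if m \<le> a \<and> a < m + 4 \<and> m \<le> b \<and> b < m + 4 then A $$ (a - m, b - m)
     else if a = b then 1 else 0)"
  using assms by (auto simp: central_block_def)

text \<open>Determinant and product of the three diagonal blocks come from applying the rules for
  \<open>four_block_mat\<close> twice, to the inner and to the outer splitting.\<close>

lemma central_block_hom: "central_block m k \<in> hom (SL 4) (SL (m + 4 + k))"
proof (rule homI)
  fix A assume "A \<in> carrier (SL 4)"
  then have A: "A \<in> carrier_mat 4 4" "det A = 1" by (auto simp: carrier_SL_iff)
  let ?D = "four_block_mat A (0\<^sub>m 4 k) (0\<^sub>m k 4) (1\<^sub>m k)"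
  have D: "?D \<in> carrier_mat (4 + k) (4 + k)" using A(1) by simp
  have "det ?D = 1"
    using A by (simp add: det_four_block_mat_upper_right_zero[where n = 4 and m = k])
  then have "det (central_block m k A) = 1"
    unfolding central_block_def
    using D by (simp add: det_four_block_mat_upper_right_zero[where n = m and m = "4 + k"])
  then show "central_block m k A \<in> carrier (SL (m + 4 + k))"
    using central_block_carrier[OF A(1)] by (simp add: carrier_SL_iff)
next
  fix A B assume "A \<in> carrier (SL 4)" "B \<in> carrier (SL 4)"
  then have c: "A \<in> carrier_mat 4 4" "B \<in> carrier_mat 4 4" by (auto simp: carrier_SL_iff)
  show "central_block m k (A \<otimes>\<^bsub>SL 4\<^esub> B) =
      central_block m k A \<otimes>\<^bsub>SL (m + 4 + k)\<^esub> central_block m k B"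
    unfolding central_block_def mult_SL using c
    by (simp add: mult_four_block_mat[of _ 4 4 _ k _ k _ _ 4 _ k]
        mult_four_block_mat[of _ m m _ "4 + k" _ "4 + k" _ _ m _ "4 + k"])
qed

lemma stabilizes_flag_central_block_iff:
  assumes A: "A \<in> carrier_mat 4 4"
  shows "stabilizes_flag (m + 4 + k) (m + 2) (central_block m k A) \<longleftrightarrow> stabilizes_flag 4 2 A"
proof
  assume *: "stabilizes_flag (m + 4 + k) (m + 2) (central_block m k A)"
  show "stabilizes_flag 4 2 A"
    unfolding stabilizes_flag_def
  proof (intro allI impI)
    fix a b :: nat assume "b < a" "a < 4" "(a, b) \<noteq> (2, 2 - 1)"
    then show "A $$ (a, b) = 0"
      using *[unfolded stabilizes_flag_def, rule_format, of "m + b" "m + a"]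
      by (auto simp: central_block_index[OF A])
  qed
next
  assume *: "stabilizes_flag 4 2 A"
  show "stabilizes_flag (m + 4 + k) (m + 2) (central_block m k A)"
    unfolding stabilizes_flag_def
  proof (intro allI impI)
    fix a b :: nat assume "b < a" "a < m + 4 + k" "(a, b) \<noteq> (m + 2, m + 2 - 1)"
    \<comment> \<open>Truncation in \<open>b - m\<close> and \<open>a - m\<close> does no harm:
      outside the central block the entry is that of the identity matrix, which is 0 because
      \<open>b < a\<close>.\<close>
    then show "central_block m k A $$ (a, b) = 0"
      using *[unfolded stabilizes_flag_def, rule_format, of "b - m" "a - m"]
      by (auto simp: central_block_index[OF A])
  qed
qed

section \<open>Morphisms from projective space with local lifts\<close>

text \<open>For a linear form \<open>l\<close> these are the degree 0 elements of the polynomial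
  ring localized at \<open>l\<close>, that is, the regular functions on the chart where
  \<open>l\<close> is nonzero, read on vectors instead of lines. Values at zeros of \<open>l\<close>
  are left free.\<close>

definition localized :: "nat \<Rightarrow> (complex vec \<Rightarrow> complex) \<Rightarrow> (complex vec \<Rightarrow> complex) set" where
  "localized N l = {F. \<exists>d p. hom_poly_fun (vec_coords (N + 1)) d p \<and>
     (\<forall>v\<in>nonzero_vecs (N + 1). l v \<noteq> 0 \<longrightarrow> F v = p v / l v ^ d)}"

lemma localizedI:
  assumes "hom_poly_fun (vec_coords (N + 1)) d p"
    and "\<And>v. v \<in> nonzero_vecs (N + 1) \<Longrightarrow> l v \<noteq> 0 \<Longrightarrow> F v = p v / l v ^ d"
  shows "F \<in> localized N l"
  using assms unfolding localized_def by blast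

lemma localizedE:
  assumes "F \<in> localized N l"
  obtains d p where "hom_poly_fun (vec_coords (N + 1)) d p"
    and "\<And>v. v \<in> nonzero_vecs (N + 1) \<Longrightarrow> l v \<noteq> 0 \<Longrightarrow> F v = p v / l v ^ d"
  using assms unfolding localized_def by blast

lemma hom_poly_fun_power:
  "hom_poly_fun C d p \<Longrightarrow> hom_poly_fun C (k * d) (\<lambda>v. p v ^ k)"
proof (induction k)
  case 0
  show ?case using hom_poly_fun.const[of C 1] by simp
next
  case (Suc k)
  then show ?case using hom_poly_fun.mult[of C d p "k * d" "\<lambda>v. p v ^ k"] by simp
qed

lemma hom_poly_fun_smult:
  assumes "hom_poly_fun (vec_coords m) d p" "v \<in> carrier_vec m"
  shows "p (c \<cdot>\<^sub>v v) = c ^ d * p v"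
  using assms
proof (induction rule: hom_poly_fun.induct)
  case (coord f)
  then show ?case by (auto simp: vec_coords_def)
qed (auto simp: algebra_simps power_add)

lemma localized_const: "(\<lambda>_. c) \<in> localized N l"
  by (rule localizedI[OF hom_poly_fun.const[of _ c]]) simp

lemma localized_mult:
  assumes "F \<in> localized N l" "G \<in> localized N l"
  shows "(\<lambda>v. F v * G v) \<in> localized N l"
proof -
  obtain d p where p: "hom_poly_fun (vec_coords (N + 1)) d p"
    "\<And>v. v \<in> nonzero_vecs (N + 1) \<Longrightarrow> l v \<noteq> 0 \<Longrightarrow> F v = p v / l v ^ d"
    using assms(1) by (rule localizedE) blast
  obtain e q where q: "hom_poly_fun (vec_coords (N + 1)) e q"
    "\<And>v. v \<in> nonzero_vecs (N + 1) \<Longrightarrow> l v \<noteq> 0 \<Longrightarrow> G v = q v / l v ^ e"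
    using assms(2) by (rule localizedE) blast
  show ?thesis
    by (rule localizedI[OF hom_poly_fun.mult[OF p(1) q(1)]]) (simp add: p(2) q(2) power_add)
qed

lemma localized_add:
  assumes l: "hom_poly_fun (vec_coords (N + 1)) 1 l"
    and "F \<in> localized N l" "G \<in> localized N l"
  shows "(\<lambda>v. F v + G v) \<in> localized N l"
proof -
  obtain d p where p: "hom_poly_fun (vec_coords (N + 1)) d p"
    "\<And>v. v \<in> nonzero_vecs (N + 1) \<Longrightarrow> l v \<noteq> 0 \<Longrightarrow> F v = p v / l v ^ d"
    using assms(2) by (rule localizedE) blast
  obtain e q where q: "hom_poly_fun (vec_coords (N + 1)) e q"
    "\<And>v. v \<in> nonzero_vecs (N + 1) \<Longrightarrow> l v \<noteq> 0 \<Longrightarrow> G v = q v / l v ^ e"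
    using assms(3) by (rule localizedE) blast
  \<comment> \<open>Over the common denominator \<open>l v ^ (d + e)\<close> both numerators become
    homogeneous of degree \<open>d + e\<close>, as their sum requires.\<close>
  have "hom_poly_fun (vec_coords (N + 1)) (d + e) (\<lambda>v. p v * l v ^ e)"
    using hom_poly_fun.mult[OF p(1) hom_poly_fun_power[OF l, of e]] by simp
  moreover have "hom_poly_fun (vec_coords (N + 1)) (d + e) (\<lambda>v. q v * l v ^ d)"
    using hom_poly_fun.mult[OF q(1) hom_poly_fun_power[OF l, of d]] by (simp add: add.commute)
  ultimately have "hom_poly_fun (vec_coords (N + 1)) (d + e) (\<lambda>v. p v * l v ^ e + q v * l v ^ d)"
    by (rule hom_poly_fun.add)
  then show ?thesis
    by (rule localizedI) (simp add: p(2) q(2) power_add field_simps)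
qed

lemma localized_sum:
  assumes l: "hom_poly_fun (vec_coords (N + 1)) 1 l"
    and "finite S" "\<And>k. k \<in> S \<Longrightarrow> (\<lambda>v. F k v) \<in> localized N l"
  shows "(\<lambda>v. \<Sum>k\<in>S. F k v) \<in> localized N l"
  using assms(2,3)
  by (induction S rule: finite_induct) (auto intro: localized_const localized_add[OF l])

lemma localized_quotient:
  assumes "hom_poly_fun (vec_coords (N + 1)) 1 f"
  shows "(\<lambda>v. f v / l v) \<in> localized N l"
  by (rule localizedI[OF assms]) simp

section \<open>Invariance under rescaling of vectors\<close>

lemma mem_line_self: "v \<in> line v"
  unfolding line_def by (auto intro!: exI[of _ 1])

lemma line_eqE:
  assumes "line v = line w" "w \<in> nonzero_vecs m"
  obtains c where "c \<noteq> 0" "w = c \<cdot>\<^sub>v v"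
proof -
  from assms(1) mem_line_self[of w] obtain c where c: "w = c \<cdot>\<^sub>v v"
    unfolding line_def by blast
  then have "dim_vec v = m" using assms(2) by (auto simp: nonzero_vecs_def)
  have "c \<noteq> 0"
  proof
    assume "c = 0"
    then have "w = 0\<^sub>v m" using c \<open>dim_vec v = m\<close> by (intro eq_vecI) auto
    with assms(2) show False by (simp add: nonzero_vecs_def)
  qed
  with c that show thesis by blast
qed

lemma hom_poly_fun_line_cong:
  assumes "hom_poly_fun (vec_coords m) d p" "line v = line w"
    and "v \<in> nonzero_vecs m" "w \<in> nonzero_vecs m"
  shows "p v = 0 \<longleftrightarrow> p w = 0"
proof -
  obtain c where "c \<noteq> 0" "w = c \<cdot>\<^sub>v v" using line_eqE assms(2,4) by blast
  with assms(1,3) show ?thesis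
    by (simp add: hom_poly_fun_smult[where m = m] nonzero_vecs_def)
qed

text \<open>Numerator and denominator scale by the same power \<open>c ^ d\<close>, so the quotient
  depends only on the line.\<close>

lemma localized_line_cong:
  assumes l: "hom_poly_fun (vec_coords (N + 1)) 1 l" and "F \<in> localized N l"
    and "line v = line w" "v \<in> nonzero_vecs (N + 1)" "w \<in> nonzero_vecs (N + 1)" "l v \<noteq> 0"
  shows "F v = F w"
proof -
  obtain d p where p: "hom_poly_fun (vec_coords (N + 1)) d p"
    "\<And>v. v \<in> nonzero_vecs (N + 1) \<Longrightarrow> l v \<noteq> 0 \<Longrightarrow> F v = p v / l v ^ d"
    using assms(2) by (rule localizedE) blast
  obtain c where c: "c \<noteq> 0" "w = c \<cdot>\<^sub>v v" using line_eqE assms(3,5) by blast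
  have v: "v \<in> carrier_vec (N + 1)" using assms(4) by (simp add: nonzero_vecs_def)
  have "F w = p w / l w ^ d"
    using hom_poly_fun_line_cong[OF l assms(3-5)] assms(5,6) by (intro p(2)) auto
  also have "\<dots> = p v / l v ^ d"
    using c v by (simp add: hom_poly_fun_smult[OF l] hom_poly_fun_smult[OF p(1)] power_mult_distrib)
  finally show ?thesis using p(2) assms(4,6) by simp
qed

lemma openin_projective_topology_basic:
  assumes "hom_poly_fun (vec_coords (N + 1)) d h"
  shows "openin (projective_topology N) (line ` {v \<in> nonzero_vecs (N + 1). h v \<noteq> 0})"
  unfolding projective_topology_def openin_topology_generated_by_iff
  using assms by (intro generate_topology_on.Basis) blast

text \<open>This encodes a morphism to SL_n from the chart where \<open>l\<close> is nonzero. It is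
  written on vectors; its entries have degree 0, so it descends to lines.\<close>

locale projective_chart_lift =
  fixes N n :: nat and l :: "complex vec \<Rightarrow> complex" and s :: "complex vec \<Rightarrow> complex mat"
  assumes linear: "hom_poly_fun (vec_coords (N + 1)) 1 l"
    and lift_in_SL: "\<And>v. v \<in> nonzero_vecs (N + 1) \<Longrightarrow> l v \<noteq> 0 \<Longrightarrow> s v \<in> carrier (SL n)"
    and lift_entry: "\<And>a b. a < n \<Longrightarrow> b < n \<Longrightarrow> (\<lambda>v. s v $$ (a, b)) \<in> localized N l"
begin

lemma poly_fun_lift:
  assumes "p \<in> poly_fun (mat_coords n)"
  shows "(\<lambda>v. p (s v)) \<in> localized N l"
  using assms
proof (induction rule: poly_fun.induct)
  case (coord f)
  then show ?case by (auto simp: mat_coords_def lift_entry)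
qed (auto intro: localized_const localized_mult localized_add[OF linear])

lemma lift_line_cong:
  assumes "line v = line w" "v \<in> nonzero_vecs (N + 1)" "w \<in> nonzero_vecs (N + 1)" "l v \<noteq> 0"
  shows "s v = s w"
proof -
  have "l w \<noteq> 0" using hom_poly_fun_line_cong[OF linear assms(1-3)] assms(4) by simp
  then have "s v \<in> carrier_mat n n" "s w \<in> carrier_mat n n"
    using lift_in_SL assms by (auto simp: carrier_SL_iff)
  then show ?thesis
    using localized_line_cong[OF linear lift_entry assms] by (intro eq_matI) auto
qed

lemma openin_lift_preimage:
  assumes "openin (zariski (SL_variety n)) U"
  shows "openin (projective_topology N) (line ` {v \<in> nonzero_vecs (N + 1). l v \<noteq> 0 \<and> s v \<in> U})"
    (is "openin ?T (?pre U)")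
proof -
  from assms have "generate_topology_on
      {{x \<in> carrier (SL n). p x \<noteq> 0} | p. p \<in> poly_fun (mat_coords n)} U"
    by (simp add: SL_variety_def affine_variety_def affine_space_topology_def
        openin_topology_generated_by_iff)
  then show ?thesis
  proof (induction rule: generate_topology_on.induct)
    case Empty
    then show ?case by simp
  next
    case (Int A B)
    \<comment> \<open>Images under \<open>line\<close> need not commute with intersections. They do
      here because two vectors on the same line have the same lift.\<close>
    have "?pre A \<inter> ?pre B \<subseteq> ?pre (A \<inter> B)"
    proof
      fix L assume "L \<in> ?pre A \<inter> ?pre B"
      then obtain v w where *: "L = line v" "v \<in> nonzero_vecs (N + 1)" "l v \<noteq> 0" "s v \<in> A"
        "L = line w" "w \<in> nonzero_vecs (N + 1)" "s w \<in> B" by auto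
      then have "s v = s w" by (intro lift_line_cong) auto
      with * show "L \<in> ?pre (A \<inter> B)" by auto
    qed
    then have "?pre (A \<inter> B) = ?pre A \<inter> ?pre B" by auto
    with Int.IH show ?case by (simp only: openin_Int)
  next
    case (UN K)
    have "?pre (\<Union>K) = (\<Union>A\<in>K. ?pre A)" by auto
    also have "openin ?T \<dots>" by (rule openin_Union) (use UN.IH in auto)
    finally show ?case .
  next
    case (Basis A)
    then obtain p where p: "p \<in> poly_fun (mat_coords n)" "A = {x \<in> carrier (SL n). p x \<noteq> 0}"
      by blast
    obtain d q where q: "hom_poly_fun (vec_coords (N + 1)) d q"
      "\<And>v. v \<in> nonzero_vecs (N + 1) \<Longrightarrow> l v \<noteq> 0 \<Longrightarrow> p (s v) = q v / l v ^ d"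
      using poly_fun_lift[OF p(1)] by (rule localizedE) blast
    \<comment> \<open>On the chart \<open>p (s v)\<close> is \<open>q v\<close> divided by a nonzero
      power of \<open>l v\<close>, so both conditions together are the nonvanishing of the single
      form \<open>l v * q v\<close>.\<close>
    have "{v \<in> nonzero_vecs (N + 1). l v \<noteq> 0 \<and> s v \<in> A} = {v \<in> nonzero_vecs (N + 1). l v * q v \<noteq> 0}"
      using q(2) lift_in_SL unfolding p(2) by auto
    then show ?case
      using openin_projective_topology_basic[OF hom_poly_fun.mult[OF linear q(1)]] by simp
  qed
qed

end

text \<open>Being a morphism is local on the source. Near each point \<open>\<phi>\<close> is the
  quotient projection after a lift, and open sets and regular functions of the quotient are exactly
  those that pull back well to SL_n, where the lift takes over.\<close>

lemma morphism_projective_space_homogeneous_space: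
  assumes lift: "\<And>v. v \<in> nonzero_vecs (N + 1) \<Longrightarrow> \<exists>l s. projective_chart_lift N n l s \<and> l v \<noteq> 0 \<and>
     (\<forall>w\<in>nonzero_vecs (N + 1). l w \<noteq> 0 \<longrightarrow> \<phi> (line w) = s w <#\<^bsub>SL n\<^esub> H)"
  shows "morphism (projective_space N) (homogeneous_space n H) \<phi>"
proof -
  let ?X = "SL_variety n" and ?P = "projective_space N" and ?\<pi> = "\<lambda>g. g <#\<^bsub>SL n\<^esub> H"
  let ?nz = "nonzero_vecs (N + 1)"
  have X: "points ?X = carrier (SL n)" by (simp add: SL_variety_def points_affine_variety)
  have P: "points ?P = line ` ?nz" by (rule points_projective_space)
  have zP: "zariski ?P = projective_topology N" by (simp add: projective_space_def)
  have pre: "\<exists>l s. projective_chart_lift N n l s \<and> l v \<noteq> 0 \<and> s v \<in> {x \<in> points ?X. ?\<pi> x \<in> V} \<and>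
      (\<forall>w\<in>?nz. l w \<noteq> 0 \<longrightarrow> \<phi> (line w) = ?\<pi> (s w))"
    if "v \<in> ?nz" "\<phi> (line v) \<in> V" for v V
  proof -
    obtain l s where ls: "projective_chart_lift N n l s" "l v \<noteq> 0"
      "\<forall>w\<in>?nz. l w \<noteq> 0 \<longrightarrow> \<phi> (line w) = ?\<pi> (s w)"
      using lift[OF \<open>v \<in> ?nz\<close>] by blast
    interpret projective_chart_lift N n l s by (rule ls(1))
    have "s v \<in> {x \<in> points ?X. ?\<pi> x \<in> V}"
      using ls that lift_in_SL X by auto
    with ls show ?thesis by blast
  qed
  have maps: "\<phi> L \<in> points (homogeneous_space n H)" if "L \<in> points ?P" for L
  proof -
    from that P obtain v where "v \<in> ?nz" "L = line v" by auto
    with pre[of v UNIV] obtain s where "s v \<in> points ?X" "\<phi> L = ?\<pi> (s v)" by blast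
    then show ?thesis
      by (simp add: homogeneous_space_def points_quotient_space)
  qed
  have "openin (zariski ?P) {L \<in> points ?P. \<phi> L \<in> V}"
    if V: "openin (zariski (homogeneous_space n H)) V" for V
  proof (subst openin_subopen, safe)
    fix L assume "L \<in> points ?P" "\<phi> L \<in> V"
    then obtain v where v: "v \<in> ?nz" "L = line v" "\<phi> (line v) \<in> V" using P by auto
    from pre[OF v(1,3)] obtain l s where ls: "projective_chart_lift N n l s" "l v \<noteq> 0"
      "s v \<in> {x \<in> points ?X. ?\<pi> x \<in> V}" "\<forall>w\<in>?nz. l w \<noteq> 0 \<longrightarrow> \<phi> (line w) = ?\<pi> (s w)"
      by blast
    interpret projective_chart_lift N n l s by (rule ls(1))
    let ?W = "line ` {w \<in> ?nz. l w \<noteq> 0 \<and> s w \<in> {x \<in> points ?X. ?\<pi> x \<in> V}}"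
    have "openin (zariski ?P) ?W"
      using V unfolding zP homogeneous_space_def openin_quotient_space
      by (intro openin_lift_preimage) blast
    moreover have "L \<in> ?W"
      unfolding v(2) using v(1) ls(2,3) by (simp only: imageI mem_Collect_eq simp_thms)
    moreover have "?W \<subseteq> {L \<in> points ?P. \<phi> L \<in> V}" 
      by (rule image_subsetI) (use ls(4) P in simp)
    ultimately show "\<exists>T. openin (zariski ?P) T \<and> L \<in> T \<and> T \<subseteq> {L \<in> points ?P. \<phi> L \<in> V}"
      by (intro exI[of _ ?W] conjI)
  qed
  moreover have "f \<circ> \<phi> \<in> regular ?P {L \<in> points ?P. \<phi> L \<in> V}"
    if f: "f \<in> regular (homogeneous_space n H) V" for V f
    unfolding projective_space_def select_convs mem_Collect_eq
  proof (rule ballI)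
    fix L assume "L \<in> {L \<in> topspace (projective_topology N). \<phi> L \<in> V}"
    then have "L \<in> line ` ?nz" "\<phi> L \<in> V" using P zP by auto
    then obtain v where v: "v \<in> ?nz" "L = line v" "\<phi> (line v) \<in> V" by auto
    from pre[OF v(1,3)] obtain l s where ls: "projective_chart_lift N n l s" "l v \<noteq> 0"
      "s v \<in> {x \<in> points ?X. ?\<pi> x \<in> V}" "\<forall>w\<in>?nz. l w \<noteq> 0 \<longrightarrow> \<phi> (line w) = ?\<pi> (s w)"
      by blast
    interpret projective_chart_lift N n l s by (rule ls(1))
    from f have "f \<circ> ?\<pi> \<in> regular ?X {x \<in> points ?X. ?\<pi> x \<in> V}"
      by (simp add: homogeneous_space_def quotient_space_def)
    then have "\<forall>x\<in>{x \<in> points ?X. ?\<pi> x \<in> V}. \<exists>W p q. openin (zariski ?X) W \<and> x \<in> W \<and>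
        W \<subseteq> {x \<in> points ?X. ?\<pi> x \<in> V} \<and> p \<in> poly_fun (mat_coords n) \<and>
        q \<in> poly_fun (mat_coords n) \<and> (\<forall>y\<in>W. q y \<noteq> 0 \<and> (f \<circ> ?\<pi>) y = p y / q y)"
      unfolding SL_variety_def affine_variety_def select_convs mem_Collect_eq .
    from bspec[OF this ls(3)] obtain U p q where U: "openin (zariski ?X) U" "s v \<in> U"
      "U \<subseteq> {x \<in> points ?X. ?\<pi> x \<in> V}" "p \<in> poly_fun (mat_coords n)" "q \<in> poly_fun (mat_coords n)"
      "\<forall>y\<in>U. q y \<noteq> 0 \<and> (f \<circ> ?\<pi>) y = p y / q y"
      by (elim exE conjE)
    obtain d p' where p': "hom_poly_fun (vec_coords (N + 1)) d p'"
      "\<And>w. w \<in> ?nz \<Longrightarrow> l w \<noteq> 0 \<Longrightarrow> p (s w) = p' w / l w ^ d"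
      using poly_fun_lift[OF U(4)] by (rule localizedE) blast
    obtain e q' where q': "hom_poly_fun (vec_coords (N + 1)) e q'"
      "\<And>w. w \<in> ?nz \<Longrightarrow> l w \<noteq> 0 \<Longrightarrow> q (s w) = q' w / l w ^ e"
      using poly_fun_lift[OF U(5)] by (rule localizedE) blast
    let ?W = "line ` {w \<in> ?nz. l w \<noteq> 0 \<and> s w \<in> U}"
    \<comment> \<open>Clearing the powers of \<open>l\<close> crosswise brings numerator and
      denominator to the common degree \<open>d + e\<close> that \<open>projective_space\<close>
      demands.\<close>
    let ?num = "\<lambda>w. p' w * l w ^ e" and ?den = "\<lambda>w. q' w * l w ^ d"
    have "openin (projective_topology N) ?W" by (rule openin_lift_preimage[OF U(1)])
    moreover have "L \<in> ?W"
      unfolding v(2) using v(1) ls(2) U(2) by (simp only: imageI mem_Collect_eq simp_thms)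
    moreover have "?W \<subseteq> {L \<in> topspace (projective_topology N). \<phi> L \<in> V}" 
      by (rule image_subsetI) (use ls(4) U(3) P zP in auto)
    moreover have "hom_poly_fun (vec_coords (N + 1)) (d + e) ?num"
      using hom_poly_fun.mult[OF p'(1) hom_poly_fun_power[OF linear, of e]] by simp
    moreover have "hom_poly_fun (vec_coords (N + 1)) (d + e) ?den"
      using hom_poly_fun.mult[OF q'(1) hom_poly_fun_power[OF linear, of d]] by (simp add: add.commute)
    moreover have "?den w \<noteq> 0 \<and> (f \<circ> \<phi>) (line w) = ?num w / ?den w"
      if w: "w \<in> ?nz" "line w \<in> ?W" for w
    proof -
      \<comment> \<open>Membership of \<open>line w\<close> in the image only provides some
        representative \<open>u\<close> on that line; invariance of the lift transfers the
        conditions to \<open>w\<close>.\<close>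
      from w(2) obtain u where u: "line w = line u" "u \<in> ?nz" "l u \<noteq> 0" "s u \<in> U" by auto
      then have "l w \<noteq> 0" using hom_poly_fun_line_cong[OF linear u(1) w(1) u(2)] by simp
      then have "s w \<in> U" using lift_line_cong[OF u(1) w(1) u(2)] u(4) by simp
      then show ?thesis
        using U(6) ls(4) w(1) \<open>l w \<noteq> 0\<close> p'(2)[of w] q'(2)[of w] by (auto simp: field_simps)
    qed
    ultimately show "\<exists>W d p q. openin (projective_topology N) W \<and> L \<in> W \<and>
        W \<subseteq> {L \<in> topspace (projective_topology N). \<phi> L \<in> V} \<and> hom_poly_fun (vec_coords (N + 1)) d p \<and>
        hom_poly_fun (vec_coords (N + 1)) d q \<and>
        (\<forall>v\<in>?nz. line v \<in> W \<longrightarrow> q v \<noteq> 0 \<and> (f \<circ> \<phi>) (line v) = p v / q v)"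
      by blast
  qed
  ultimately show ?thesis
    unfolding morphism_def continuous_map_def using maps by auto
qed

section \<open>The null correlation\<close>

lemma eq_vec_carrierI:
  assumes "v \<in> carrier_vec n" "w \<in> carrier_vec n" "\<And>a. a < n \<Longrightarrow> v $ a = w $ a"
  shows "v = w"
  using assms by (intro eq_vecI) auto

lemma Sp4_carrier: "A \<in> Sp4 \<Longrightarrow> A \<in> carrier (SL 4) \<and> A \<in> carrier_mat 4 4"
  by (simp add: Sp4_def carrier_SL_iff)

text \<open>Column 0 pairs to 1 with column 3, so it cannot vanish.\<close>

lemma Sp4_col_nonzero:
  assumes "A \<in> Sp4"
  shows "col A 0 \<noteq> 0\<^sub>v 4"
proof
  assume "col A 0 = 0\<^sub>v 4"
  then have "A $$ (a, 0) = 0" if "a < 4" for a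
    using that Sp4_carrier[OF assms] by (metis carrier_matD index_col index_zero_vec(1) zero_less_numeral)
  then have "symplectic_form $$ (0, 3) = 0"
    using assms unfolding Sp4_iff by force
  then show False by (simp add: symplectic_form_def)
qed

text \<open>For a symplectic matrix, preserving the flag means preserving the line of e_0. The
  quotient sends e_0 to the inverse of \<open>A\<close> applied to column 0 of \<open>B\<close>, and
  applying \<open>A\<close> turns a multiple of e_0 into the same multiple of column 0 of
  \<open>A\<close>.\<close>

lemma Sp4_same_line_iff:
  assumes A: "A \<in> Sp4" and B: "B \<in> Sp4"
  shows "stabilizes_flag 4 2 (inv\<^bsub>SL 4\<^esub> A * B) \<longleftrightarrow> (\<exists>c. col B 0 = c \<cdot>\<^sub>v col A 0)"
proof -
  interpret group "SL 4" by (rule group_SL)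
  define A' where "A' = inv\<^bsub>SL 4\<^esub> A"
  define Q where "Q = A' * B"
  have c: "A \<in> carrier (SL 4)" "B \<in> carrier (SL 4)" using A B Sp4_carrier by auto
  then have "A' \<in> carrier (SL 4)" by (simp add: A'_def)
  with c have cm: "A \<in> carrier_mat 4 4" "B \<in> carrier_mat 4 4" "A' \<in> carrier_mat 4 4"
    by (auto simp: carrier_SL_iff)
  then have Qm: "Q \<in> carrier_mat 4 4" by (simp add: Q_def mult_carrier_mat[of _ 4 4])
  have "Q \<in> Sp4"
    using subgroup.m_closed[OF subgroup_Sp4 subgroup.m_inv_closed[OF subgroup_Sp4 A] B]
    by (simp add: Q_def A'_def)
  have inverse: "A * A' = 1\<^sub>m 4" "A' * A = 1\<^sub>m 4"
    using r_inv[OF c(1)] l_inv[OF c(1)] by (auto simp: A'_def)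
  have "A * Q = B"
    using cm inverse by (simp add: Q_def flip: assoc_mult_mat[of A 4 4 A' 4 B 4])
  have colA: "col A 0 = A *\<^sub>v unit_vec 4 0"
    using cm by (metis col_mult2 col_one left_mult_one_mat one_carrier_mat right_mult_one_mat zero_less_numeral)
  have colQ: "col Q 0 = A' *\<^sub>v col B 0"
    unfolding Q_def by (rule col_mult2[OF cm(3,2)]) simp
  have colQ_carrier: "col Q 0 \<in> carrier_vec 4"
    unfolding colQ using cm(3) by (rule mult_mat_vec_carrier) (rule col_carrier_vec[OF _ cm(2)], simp)
  have "stabilizes_flag 4 2 Q \<longleftrightarrow> (\<exists>c. col Q 0 = c \<cdot>\<^sub>v unit_vec 4 0)"
  proof
    assume "stabilizes_flag 4 2 Q"
    then have "col Q 0 $ a = (Q $$ (0, 0) \<cdot>\<^sub>v unit_vec 4 0) $ a" if "a < 4" for a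
      using less_4_cases[OF that] Qm by (auto simp: stabilizes_flag_def)
    from eq_vec_carrierI[OF colQ_carrier _ this]
    have "col Q 0 = Q $$ (0, 0) \<cdot>\<^sub>v unit_vec 4 0" by simp
    then show "\<exists>c. col Q 0 = c \<cdot>\<^sub>v unit_vec 4 0" by blast
  next
    assume "\<exists>c. col Q 0 = c \<cdot>\<^sub>v unit_vec 4 0"
    then obtain d where d: "col Q 0 = d \<cdot>\<^sub>v unit_vec 4 0" by blast
    have "Q $$ (a, 0) = (d \<cdot>\<^sub>v unit_vec 4 0) $ a" if "a < 4" for a
      using Qm that by (simp flip: d)
    then show "stabilizes_flag 4 2 Q"
      using Sp4_stabilizes_flag_iff[OF \<open>Q \<in> Sp4\<close>] by simp
  qed
  also have "\<dots> \<longleftrightarrow> (\<exists>c. col B 0 = c \<cdot>\<^sub>v col A 0)"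
  proof (intro iff_exI iffI)
    fix d assume d: "col Q 0 = d \<cdot>\<^sub>v unit_vec 4 0"
    have "col B 0 = A *\<^sub>v col Q 0"
      using col_mult2[OF cm(1) Qm, of 0] \<open>A * Q = B\<close> by simp
    also have "\<dots> = d \<cdot>\<^sub>v col A 0"
      unfolding d colA by (rule mult_mat_vec[OF cm(1)]) simp
    finally show "col B 0 = d \<cdot>\<^sub>v col A 0" .
  next
    fix d assume d: "col B 0 = d \<cdot>\<^sub>v col A 0"
    have "col Q 0 = d \<cdot>\<^sub>v (A' *\<^sub>v col A 0)"
      unfolding colQ d by (rule mult_mat_vec[OF cm(3) col_carrier_vec[OF _ cm(1)]]) simp
    also have "A' *\<^sub>v col A 0 = (A' * A) *\<^sub>v unit_vec 4 0"
      unfolding colA using cm by (intro assoc_mult_mat_vec[symmetric]) auto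
    also have "\<dots> = unit_vec 4 0" by (simp add: inverse)
    finally show "col Q 0 = d \<cdot>\<^sub>v unit_vec 4 0" .
  qed
  finally show ?thesis by (simp add: Q_def A'_def)
qed

text \<open>Closure of the stabilizer under products gives one inclusion of cosets; equality comes
  from using it for a quotient of two matrices and for the reverse quotient.\<close>

lemma minimal_parabolic_lcoset_mono:
  assumes i: "1 \<le> i" "i < n" and "g \<in> carrier (SL n)" "q \<in> minimal_parabolic n i"
  shows "(g * q) <#\<^bsub>SL n\<^esub> minimal_parabolic n i \<subseteq> g <#\<^bsub>SL n\<^esub> minimal_parabolic n i"
proof
  interpret group "SL n" by (rule group_SL)
  fix x assume "x \<in> (g * q) <#\<^bsub>SL n\<^esub> minimal_parabolic n i"
  then obtain p where p: "p \<in> minimal_parabolic n i" "x = g * q * p"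
    by (auto simp: l_coset_def)
  have c: "p \<in> carrier (SL n)" "q \<in> carrier (SL n)"
    using p(1) assms(4) by (auto simp: minimal_parabolic_eq[OF i])
  have "q * p \<in> carrier (SL n)" using m_closed[OF c(2,1)] by simp
  moreover have "stabilizes_flag n i (q * p)"
    using p(1) assms(4) c
    by (intro stabilizes_flag_mult) (auto simp: minimal_parabolic_eq[OF i] carrier_SL_iff)
  ultimately have "q * p \<in> minimal_parabolic n i" by (simp add: minimal_parabolic_eq[OF i])
  moreover have "x = g * (q * p)" using p(2) m_assoc[OF assms(3) c(2,1)] by simp
  ultimately show "x \<in> g <#\<^bsub>SL n\<^esub> minimal_parabolic n i"
    by (auto simp: l_coset_def)
qed

text \<open>Equality of the cosets means that the embedded quotient of \<open>A\<close> and
  \<open>B\<close> lies in the parabolic, which by the block structure is a question about the flag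
  in dimension 4. One direction makes the coset a function of the line alone, the other separates
  distinct lines.\<close>

lemma central_block_coset_eq_iff:
  assumes n: "n = m + 4 + k" "i = m + 2" and A: "A \<in> Sp4" and B: "B \<in> Sp4"
  shows "central_block m k A <#\<^bsub>SL n\<^esub> minimal_parabolic n i =
      central_block m k B <#\<^bsub>SL n\<^esub> minimal_parabolic n i \<longleftrightarrow> (\<exists>c. col B 0 = c \<cdot>\<^sub>v col A 0)"
    (is "?lhs \<longleftrightarrow> _")
proof -
  let ?P = "minimal_parabolic n i" and ?e = "central_block m k"
  have i: "1 \<le> i" "i < n" using n by auto
  interpret group_hom "SL 4" "SL n" ?e
    using central_block_hom by (simp add: group_hom_def group_hom_axioms_def group_SL n(1))
  have quot: "?e X * ?e (inv\<^bsub>SL 4\<^esub> X * Y) = ?e Y \<and>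
      (?e (inv\<^bsub>SL 4\<^esub> X * Y) \<in> ?P \<longleftrightarrow> (\<exists>c. col Y 0 = c \<cdot>\<^sub>v col X 0))"
    if "X \<in> Sp4" "Y \<in> Sp4" for X Y
  proof -
    have c: "X \<in> carrier (SL 4)" "Y \<in> carrier (SL 4)" using that Sp4_carrier by auto
    then have Q: "inv\<^bsub>SL 4\<^esub> X * Y \<in> carrier (SL 4)"
      using G.m_closed[of "inv\<^bsub>SL 4\<^esub> X" Y] by simp
    then have "?e (inv\<^bsub>SL 4\<^esub> X * Y) \<in> ?P \<longleftrightarrow> stabilizes_flag 4 2 (inv\<^bsub>SL 4\<^esub> X * Y)"
      using hom_closed[OF Q] stabilizes_flag_central_block_iff[of "inv\<^bsub>SL 4\<^esub> X * Y" m k]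
      unfolding minimal_parabolic_eq[OF i] unfolding n by (simp add: carrier_SL_iff)
    moreover have "?e X * ?e (inv\<^bsub>SL 4\<^esub> X * Y) = ?e (X * (inv\<^bsub>SL 4\<^esub> X * Y))"
      using hom_mult[OF c(1) Q] by simp
    moreover have "X * (inv\<^bsub>SL 4\<^esub> X * Y) = Y"
      using G.inv_solve_left[of "inv\<^bsub>SL 4\<^esub> X * Y" X Y] c Q by simp
    ultimately show ?thesis using Sp4_same_line_iff[OF that] by simp
  qed
  have subset: "?e Y <#\<^bsub>SL n\<^esub> ?P \<subseteq> ?e X <#\<^bsub>SL n\<^esub> ?P"
    if "X \<in> Sp4" "Y \<in> Sp4" "\<exists>c. col Y 0 = c \<cdot>\<^sub>v col X 0" for X Y
    using minimal_parabolic_lcoset_mono[OF i, of "?e X" "?e (inv\<^bsub>SL 4\<^esub> X * Y)"]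
      quot[OF that(1,2)] that Sp4_carrier by auto
  show ?thesis
  proof
    assume ?lhs
    have "1\<^sub>m n \<in> ?P"
      by (simp add: minimal_parabolic_eq[OF i] carrier_SL_iff stabilizes_flag_def)
    then have "?e B \<in> ?e B <#\<^bsub>SL n\<^esub> ?P"
      using H.r_one[of "?e B"] B Sp4_carrier unfolding l_coset_def
      by (auto intro!: bexI[of _ "1\<^sub>m n"])
    with \<open>?lhs\<close> obtain p where p: "p \<in> ?P" "?e B = ?e A * p" by (auto simp: l_coset_def)
    have c: "p \<in> carrier (SL n)" "?e A \<in> carrier (SL n)" "?e (inv\<^bsub>SL 4\<^esub> A * B) \<in> carrier (SL n)"
      using p(1) A B Sp4_carrier G.m_closed[of "inv\<^bsub>SL 4\<^esub> A" B] by (auto simp: minimal_parabolic_eq[OF i])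
    have "p = ?e (inv\<^bsub>SL 4\<^esub> A * B)"
      using quot[OF A B] p(2) H.Units_l_cancel[of "?e A" p "?e (inv\<^bsub>SL 4\<^esub> A * B)"] c H.Units_eq by simp
    with p(1) quot[OF A B] show "\<exists>c. col B 0 = c \<cdot>\<^sub>v col A 0" by simp
  next
    assume *: "\<exists>c. col B 0 = c \<cdot>\<^sub>v col A 0"
    then obtain c where c: "col B 0 = c \<cdot>\<^sub>v col A 0" by blast
    \<comment> \<open>A nonzero scalar makes the condition symmetric in \<open>A\<close> and
      \<open>B\<close>, which yields the second inclusion.\<close>
    have "c \<noteq> 0"
    proof
      assume "c = 0"
      then have "col B 0 = 0\<^sub>v 4"
        using c Sp4_carrier[OF A] by (intro eq_vecI) auto
      with Sp4_col_nonzero[OF B] show False by simp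
    qed
    then have "col A 0 = inverse c \<cdot>\<^sub>v col B 0"
      unfolding c by (simp add: smult_smult_assoc)
    with * subset[OF A B] subset[OF B A] show ?lhs by blast
  qed
qed

section \<open>Symplectic lifts with regular entries\<close>

definition linear_form :: "complex mat \<Rightarrow> nat \<Rightarrow> complex vec \<Rightarrow> complex" where
  "linear_form A j v = (\<Sum>k = 0..<4. A $$ (j, k) * v $ k)"

lemma linear_form_eq:
  assumes "A \<in> carrier_mat 4 4" "v \<in> carrier_vec 4" "j < 4"
  shows "linear_form A j v = (A *\<^sub>v v) $ j"
  using assms by (simp add: linear_form_def scalar_prod_def)

lemma hom_poly_fun_linear_form: "hom_poly_fun (vec_coords 4) 1 (linear_form A j)"
proof -
  have "hom_poly_fun (vec_coords 4) 1 (\<lambda>v. A $$ (j, k) * v $ k)" if "k < 4" for k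
    using hom_poly_fun.mult[OF hom_poly_fun.const hom_poly_fun.coord[of "\<lambda>v. v $ k"], of "vec_coords 4"] that
    by (auto simp: vec_coords_def)
  then show ?thesis
    unfolding linear_form_def sum_less_4 by (intro hom_poly_fun.add) auto
qed

text \<open>The unipotent factor has first column \<open>A *\<^sub>v v\<close> normalized to leading
  coordinate 1, and the inverse of \<open>A\<close> carries this column back to a multiple of
  \<open>v\<close>. Where \<open>linear_form A 0 v\<close> is 0, division by zero makes the
  unipotent factor the identity, so the value stays in \<open>Sp4\<close> for every
  \<open>v\<close>.\<close>

definition Sp4_lift :: "complex mat \<Rightarrow> complex vec \<Rightarrow> complex mat" where
  "Sp4_lift A v = inv\<^bsub>SL 4\<^esub> A *
     Sp4_unipotent (linear_form A 1 v / linear_form A 0 v)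
       (linear_form A 2 v / linear_form A 0 v) (linear_form A 3 v / linear_form A 0 v)"

lemma Sp4_lift_in_Sp4: "A \<in> Sp4 \<Longrightarrow> Sp4_lift A v \<in> Sp4"
  using subgroup.m_closed[OF subgroup_Sp4 subgroup.m_inv_closed[OF subgroup_Sp4] Sp4_unipotent_in_Sp4]
  by (simp add: Sp4_lift_def)

lemma col_Sp4_lift:
  assumes A: "A \<in> Sp4" and v: "v \<in> carrier_vec 4" and "linear_form A 0 v \<noteq> 0"
  shows "col (Sp4_lift A v) 0 = inverse (linear_form A 0 v) \<cdot>\<^sub>v v"
proof -
  interpret group "SL 4" by (rule group_SL)
  let ?l = "\<lambda>j. linear_form A j v"
  let ?U = "Sp4_unipotent (?l 1 / ?l 0) (?l 2 / ?l 0) (?l 3 / ?l 0)"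
  have c: "A \<in> carrier (SL 4)" "inv\<^bsub>SL 4\<^esub> A \<in> carrier (SL 4)"
    using Sp4_carrier[OF A] by auto
  then have cm: "A \<in> carrier_mat 4 4" "inv\<^bsub>SL 4\<^esub> A \<in> carrier_mat 4 4"
    by (simp_all only: carrier_SL_iff)
  have "col ?U 0 $ j = (inverse (?l 0) \<cdot>\<^sub>v (A *\<^sub>v v)) $ j" if "j < 4" for j
  proof -
    have "col ?U 0 $ j = ?l j / ?l 0"
      using less_4_cases[OF that] assms(3)
      by (elim disjE) (simp_all add: Sp4_unipotent_rows)
    then show ?thesis
      using that cm v linear_form_eq[OF cm(1) v that] by (simp add: divide_inverse mult.commute)
  qed
  moreover have "col ?U 0 \<in> carrier_vec 4"
    by (rule col_carrier_vec[OF _ Sp4_unipotent_carrier]) simp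
  moreover have "inverse (?l 0) \<cdot>\<^sub>v (A *\<^sub>v v) \<in> carrier_vec 4"
    using mult_mat_vec_carrier[OF cm(1) v] by simp
  ultimately have U: "col ?U 0 = inverse (?l 0) \<cdot>\<^sub>v (A *\<^sub>v v)"
    by (intro eq_vec_carrierI[of _ 4])
  have "col (Sp4_lift A v) 0 = inv\<^bsub>SL 4\<^esub> A *\<^sub>v col ?U 0"
    unfolding Sp4_lift_def by (rule col_mult2[OF cm(2) Sp4_unipotent_carrier]) simp
  also have "\<dots> = inverse (?l 0) \<cdot>\<^sub>v (inv\<^bsub>SL 4\<^esub> A *\<^sub>v (A *\<^sub>v v))"
    unfolding U using cm v by (intro mult_mat_vec) auto
  also have "inv\<^bsub>SL 4\<^esub> A *\<^sub>v (A *\<^sub>v v) = (inv\<^bsub>SL 4\<^esub> A * A) *\<^sub>v v"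
    using cm v by (intro assoc_mult_mat_vec[symmetric])
  also have "\<dots> = v" using l_inv[OF c(1)] v by simp
  finally show ?thesis .
qed

lemma Sp4_lift_entry:
  assumes "A \<in> Sp4" "a < 4" "b < 4"
  shows "(\<lambda>v. Sp4_lift A v $$ (a, b)) \<in> localized 3 (linear_form A 0)"
proof -
  interpret group "SL 4" by (rule group_SL)
  let ?l = "linear_form A"
  have lin: "hom_poly_fun (vec_coords (3 + 1)) 1 (?l j)" for j
    using hom_poly_fun_linear_form by simp
  let ?U = "\<lambda>v. Sp4_unipotent (?l 1 v / ?l 0 v) (?l 2 v / ?l 0 v) (?l 3 v / ?l 0 v)"
  note quot = localized_quotient[OF lin]
  have neg: "(\<lambda>v. - (?l 1 v / ?l 0 v)) \<in> localized 3 (?l 0)"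
    using localized_mult[OF localized_const[of "-1"] quot] by simp
  have U: "(\<lambda>v. ?U v $$ (c, b)) \<in> localized 3 (?l 0)" if "c < 4" for c
    using less_4_cases[OF that] less_4_cases[OF \<open>b < 4\<close>]
    by (elim disjE) (simp_all add: Sp4_unipotent_rows localized_const quot quot[of 1, simplified]
        neg[simplified])
  have cm: "inv\<^bsub>SL 4\<^esub> A \<in> carrier_mat 4 4"
    using Sp4_carrier[OF assms(1)] inv_closed[of A] by (simp only: carrier_SL_iff)
  have "(\<lambda>v. Sp4_lift A v $$ (a, b)) = (\<lambda>v. \<Sum>c = 0..<4. (inv\<^bsub>SL 4\<^esub> A) $$ (a, c) * ?U v $$ (c, b))"
    using assms(2,3) carrier_matD[OF cm] by (simp add: Sp4_lift_def scalar_prod_def)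
  also have "\<dots> \<in> localized 3 (?l 0)"
    by (intro localized_sum[OF lin] localized_mult localized_const U) auto
  finally show ?thesis .
qed

text \<open>A transposed unipotent matrix has first row (1, x, y, z) with free x, y, z. All three
  are taken 0 if the leading coordinate of \<open>v\<close> is nonzero; otherwise a single 1 picks
  out a nonzero coordinate. Hence the charts cover projective space.\<close>

lemma ex_Sp4_linear_form_nonzero:
  assumes "v \<in> nonzero_vecs 4"
  shows "\<exists>A\<in>Sp4. linear_form A 0 v \<noteq> 0"
proof -
  have v: "v \<in> carrier_vec 4" "v \<noteq> 0\<^sub>v 4" using assms by (auto simp: nonzero_vecs_def)
  have form: "linear_form (transpose_mat (Sp4_unipotent x y z)) 0 v = v $ 0 + x * v $ 1 + y * v $ 2 + z * v $ 3"
    for x y z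
    by (simp add: linear_form_def sum_less_4 Sp4_unipotent_rows)
  have "\<exists>j<4. v $ j \<noteq> 0"
  proof (rule ccontr)
    assume "\<not> (\<exists>j<4. v $ j \<noteq> 0)"
    then have "v = 0\<^sub>v 4" using v(1) by (intro eq_vecI) auto
    with v(2) show False ..
  qed
  then obtain j where j: "j < 4" "v $ j \<noteq> 0" by blast
  have "v $ 0 \<noteq> 0 \<or> v $ 1 \<noteq> 0 \<or> v $ 2 \<noteq> 0 \<or> v $ 3 \<noteq> 0"
    using less_4_cases[OF j(1)] j(2) by (elim disjE) simp_all
  then consider "v $ 0 \<noteq> 0" | "v $ 0 = 0" "v $ 1 \<noteq> 0" | "v $ 0 = 0" "v $ 2 \<noteq> 0" | "v $ 0 = 0" "v $ 3 \<noteq> 0"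
    by blast
  then have "\<exists>x y z. v $ 0 + x * v $ 1 + y * v $ 2 + z * v $ 3 \<noteq> 0"
  proof cases
    case 1
    then have "v $ 0 + 0 * v $ 1 + 0 * v $ 2 + 0 * v $ 3 \<noteq> 0" by simp
    then show ?thesis by blast
  next
    case 2
    then have "v $ 0 + 1 * v $ 1 + 0 * v $ 2 + 0 * v $ 3 \<noteq> 0" by simp
    then show ?thesis by blast
  next
    case 3
    then have "v $ 0 + 0 * v $ 1 + 1 * v $ 2 + 0 * v $ 3 \<noteq> 0" by simp
    then show ?thesis by blast
  next
    case 4
    then have "v $ 0 + 0 * v $ 1 + 0 * v $ 2 + 1 * v $ 3 \<noteq> 0" by simp
    then show ?thesis by blast
  qed
  then obtain x y z where "v $ 0 + x * v $ 1 + y * v $ 2 + z * v $ 3 \<noteq> 0" by blast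
  then show ?thesis
    by (intro bexI[OF _ transpose_Sp4_unipotent_in_Sp4[of x y z]]) (simp add: form)
qed

section \<open>The morphism and its nonconstancy\<close>

lemma morphism_into_central_flags:
  assumes n: "n = m + 4 + k" "i = m + 2"
  shows "\<exists>\<phi>. morphism (projective_space 3) (homogeneous_space n (minimal_parabolic n i)) \<phi> \<and>
             (\<exists>x\<in>points (projective_space 3). \<exists>y\<in>points (projective_space 3). \<phi> x \<noteq> \<phi> y)"
proof -
  let ?P = "minimal_parabolic n i"
  \<comment> \<open>The matrix is chosen independently for each line, with no regularity in
    \<open>L\<close>; by \<open>\<phi>_eq\<close> its coset agrees with that of every other choice,
    in particular with the regular local lifts.\<close>
  define rep where "rep L = (SOME A. A \<in> Sp4 \<and> col A 0 \<in> L)" for L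
  define \<phi> where "\<phi> L = central_block m k (rep L) <#\<^bsub>SL n\<^esub> ?P" for L
  have lift_col: "col (Sp4_lift A v) 0 \<in> line v"
    if "A \<in> Sp4" "v \<in> nonzero_vecs 4" "linear_form A 0 v \<noteq> 0" for A v
    using col_Sp4_lift[of A v] that by (auto simp: nonzero_vecs_def line_def)
  have rep: "rep (line v) \<in> Sp4" "col (rep (line v)) 0 \<in> line v" if "v \<in> nonzero_vecs 4" for v
  proof -
    obtain A where "A \<in> Sp4" "linear_form A 0 v \<noteq> 0"
      using ex_Sp4_linear_form_nonzero[OF \<open>v \<in> nonzero_vecs 4\<close>] by blast
    then have "Sp4_lift A v \<in> Sp4 \<and> col (Sp4_lift A v) 0 \<in> line v"
      using Sp4_lift_in_Sp4 lift_col that by blast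
    then have "rep (line v) \<in> Sp4 \<and> col (rep (line v)) 0 \<in> line v"
      unfolding rep_def by (rule someI)
    then show "rep (line v) \<in> Sp4" "col (rep (line v)) 0 \<in> line v" by auto
  qed
  have \<phi>_eq: "\<phi> (line v) = central_block m k A <#\<^bsub>SL n\<^esub> ?P"
    if v: "v \<in> nonzero_vecs 4" and A: "A \<in> Sp4" "col A 0 \<in> line v" for v A
  proof -
    obtain a b where ab: "col A 0 = a \<cdot>\<^sub>v v" "col (rep (line v)) 0 = b \<cdot>\<^sub>v v"
      using A(2) rep(2)[OF v] by (auto simp: line_def)
    have "b \<noteq> 0"
    proof
      assume "b = 0"
      then have "col (rep (line v)) 0 = 0\<^sub>v 4"
        using ab(2) v by (intro eq_vecI) (auto simp: nonzero_vecs_def)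
      with Sp4_col_nonzero[OF rep(1)[OF v]] show False by simp
    qed
    then have "col A 0 = (a / b) \<cdot>\<^sub>v col (rep (line v)) 0"
      by (simp add: ab smult_smult_assoc)
    then show ?thesis
      unfolding \<phi>_def central_block_coset_eq_iff[OF n rep(1)[OF v] A(1)] by blast
  qed
  have "morphism (projective_space 3) (homogeneous_space n ?P) \<phi>"
  proof (rule morphism_projective_space_homogeneous_space)
    fix v assume "v \<in> nonzero_vecs (3 + 1)"
    then have v: "v \<in> nonzero_vecs 4" by simp
    obtain A where A: "A \<in> Sp4" "linear_form A 0 v \<noteq> 0"
      using ex_Sp4_linear_form_nonzero[OF v] by blast
    \<comment> \<open>The matrix \<open>A\<close> is chosen for \<open>v\<close> and then kept
      fixed, so that the lift is regular on the whole chart where \<open>linear_form A 0\<close> is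
      nonzero.\<close>
    let ?s = "\<lambda>w. central_block m k (Sp4_lift A w)"
    have "projective_chart_lift 3 n (linear_form A 0) ?s"
    proof
      show "hom_poly_fun (vec_coords (3 + 1)) 1 (linear_form A 0)"
        using hom_poly_fun_linear_form by simp
      show "?s w \<in> carrier (SL n)" for w
        using hom_in_carrier[OF central_block_hom] Sp4_carrier Sp4_lift_in_Sp4[OF A(1)] n(1) by blast
      fix a b assume ab: "a < n" "b < n"
      have lift: "Sp4_lift A w \<in> carrier_mat 4 4" for w
        using Sp4_carrier[OF Sp4_lift_in_Sp4[OF A(1)]] by simp
      show "(\<lambda>w. ?s w $$ (a, b)) \<in> localized 3 (linear_form A 0)"
      proof (cases "m \<le> a \<and> a < m + 4 \<and> m \<le> b \<and> b < m + 4")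
        case True
        then have "(\<lambda>w. ?s w $$ (a, b)) = (\<lambda>w. Sp4_lift A w $$ (a - m, b - m))"
          using ab n(1) by (simp add: central_block_index[OF lift])
        with True Sp4_lift_entry[OF A(1), of "a - m" "b - m"] show ?thesis by auto
      next
        case False
        then have "(\<lambda>w. ?s w $$ (a, b)) = (\<lambda>w. if a = b then 1 else 0)"
          using ab n(1) by (simp only: central_block_index[OF lift] if_False)
        then show ?thesis by (simp only: localized_const)
      qed
    qed
    moreover have "\<phi> (line w) = ?s w <#\<^bsub>SL n\<^esub> ?P"
      if "w \<in> nonzero_vecs (3 + 1)" "linear_form A 0 w \<noteq> 0" for w
      using that A(1) by (intro \<phi>_eq Sp4_lift_in_Sp4 lift_col) auto
    ultimately show "\<exists>l s. projective_chart_lift 3 n l s \<and> l v \<noteq> 0 \<and>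
        (\<forall>w\<in>nonzero_vecs (3 + 1). l w \<noteq> 0 \<longrightarrow> \<phi> (line w) = s w <#\<^bsub>SL n\<^esub> ?P)"
      using A(2) by blast
  qed
  moreover have "\<phi> (line (unit_vec 4 0)) \<noteq> \<phi> (line (unit_vec 4 1))"
  proof
    have nz: "unit_vec 4 0 \<in> nonzero_vecs 4" "unit_vec 4 1 \<in> nonzero_vecs 4"
      by (auto simp: nonzero_vecs_def)
    let ?A = "rep (line (unit_vec 4 0))" and ?B = "rep (line (unit_vec 4 1))"
    assume "\<phi> (line (unit_vec 4 0)) = \<phi> (line (unit_vec 4 1))"
    then obtain c where c: "col ?B 0 = c \<cdot>\<^sub>v col ?A 0"
      unfolding \<phi>_def central_block_coset_eq_iff[OF n rep(1)[OF nz(1)] rep(1)[OF nz(2)]] by blast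
    obtain a b where ab: "col ?A 0 = a \<cdot>\<^sub>v unit_vec 4 0" "col ?B 0 = b \<cdot>\<^sub>v unit_vec 4 1"
      using rep(2)[OF nz(1)] rep(2)[OF nz(2)] by (auto simp: line_def)
    \<comment> \<open>Two distinct coordinate lines are compared at coordinate 1, where the vector
      on the line of e_0 vanishes.\<close>
    have "(b \<cdot>\<^sub>v unit_vec 4 1) $ 1 = (c \<cdot>\<^sub>v (a \<cdot>\<^sub>v unit_vec 4 0)) $ 1"
      using c unfolding ab by simp
    then have "b = 0" by simp
    then have "col ?B 0 = 0\<^sub>v 4" unfolding ab by (intro eq_vecI) auto
    with Sp4_col_nonzero[OF rep(1)[OF nz(2)]] show False by simp
  qed
  moreover have "line (unit_vec 4 0) \<in> points (projective_space 3)"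
    "line (unit_vec 4 1) \<in> points (projective_space 3)"
    unfolding points_projective_space by (auto simp: nonzero_vecs_def)
  ultimately show ?thesis by blast
qed

theorem theorem4p7:
  fixes n i :: nat
  assumes "i \<in> {1..n - 1}"
    and "simple_root n i \<notin> {simple_root n 1, simple_root n (n - 1)}"
  shows "\<exists>\<phi>. morphism (projective_space 3) (homogeneous_space n (minimal_parabolic n i)) \<phi> \<and>
             (\<exists>x\<in>points (projective_space 3). \<exists>y\<in>points (projective_space 3). \<phi> x \<noteq> \<phi> y)"
proof -
  \<comment> \<open>Equal indices give equal roots, so excluding the two outer roots excludes their
    indices.\<close>
  have "i \<noteq> 1" "i \<noteq> n - 1" using assms(2) by auto
  \<comment> \<open>Now 2 \<le> i \<le> n - 2, so both truncated subtractions are exact and the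
    block occupies the 1-based positions \<open>i - 1\<close> to \<open>i + 2\<close>.\<close>
  with assms(1) have "n = (i - 2) + 4 + (n - i - 2)" "i = (i - 2) + 2" by auto
  then show ?thesis by (rule morphism_into_central_flags)
qed

end
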